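(* Let $p$ be a prime number, let $d \geq 2$, and let $f : \hat{\mathbb{C}}_p \rightarrow \hat{\mathbb{C}}_p$ be a polynomial map of degree $d$ over $\mathbb{C}_p$. Suppose that the Julia set $\mathcal{J}(f)$ of $f$ is non-empty and that there exists a non-empty set $B \subset \mathbb{C}_p$ satisfying the following conditions. (1) $f$ is immediately expanding on $B$, that is, there exists $\lambda > 1$ such that $|f'(z)|_p \geq \lambda$ for every $z \in B$. (2) $B$ is backward invariant under $f$, that is, $f^{-1}(B) \subset B$. (3) There exists a positive real number $M$ such that $B \subset \overline{D}_M(0)$. (4) There exists a positive real number $\delta$ such that $\overline{D}_\delta(z) \subset B$ for every $z \in B$. Then $f$ is $J$-stable in $Poly_d(\mathbb{C}_p)$, that is, there exists a neighborhood $U$ of $f$ in $Poly_d(\mathbb{C}_p)$ such that for every $g \in U$ there exists a homeomorphism $h : \mathcal{J}(f) \rightarrow \mathcal{J}(g)$ with $h \circ f = g \circ h$ on $\mathcal{J}(f)$.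
   Context: $\mathbb{C}_p$ is the field of $p$-adic complex numbers (the completion of the algebraic closure of the completion of $\mathbb{Q}$ with respect to the $p$-adic norm), with norm $|\cdot|_p$ extending the $p$-adic norm on $\mathbb{Q}$ normalized by $|p|_p = p^{-1}$. For $a \in \mathbb{C}_p$ and $r>0$, $\overline{D}_r(a) = \{z \in \mathbb{C}_p \mid |z-a|_p \leq r\}$. $\hat{\mathbb{C}}_p = \mathbb{C}_p \cup \{\infty\}$ is the projective line with the chordal metric $\rho_p(z,w) = \frac{|z-w|_p}{\max\{|z|_p,1\}\max\{|w|_p,1\}}$ for $z,w \in \mathbb{C}_p$, $\rho_p(z,\infty) = \frac{1}{\max\{|z|_p,1\}}$ for $z \in \mathbb{C}_p$, and $\rho_p(\infty,\infty)=0$. A polynomial map $f$ is extended to $\hat{\mathbb{C}}_p$ by $f(\infty)=\infty$. $f^n$ denotes the $n$-th iterate. The Fatou set $\mathcal{F}(f)$ is the largest open subset of $\hat{\mathbb{C}}_p$ on which the family $\{f^n\}_{n \in \mathbb{N}}$ is equicontinuous (at every point, with respect to $\rho_p$); the Julia set is $\mathcal{J}(f) = \hat{\mathbb{C}}_p \setminus \mathcal{F}(f)$. For polynomial maps $\infty \in \mathcal{F}(f)$ and $\mathcal{J}(f)$ is a bounded subset of $\mathbb{C}_p$. Julia sets carry the subspace topology. $Poly_d(\mathbb{C}_p)$ is the set of polynomial maps $a_d z^d + \cdots + a_0$ of degree $d$ over $\mathbb{C}_p$, with the topology of $\mathbb{C}_p^{\times} \times \mathbb{C}_p^{d}$ via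 the coefficients $(a_d, a_{d-1}, \dots, a_0)$, where $\mathbb{C}_p^\times = \mathbb{C}_p \setminus \{0\}$. *)

theory Defs
  imports
    "HOL-Analysis.Analysis"
    "HOL-Computational_Algebra.Computational_Algebra"
begin

text \<open>
  Fields of characteristic 0 with a non-archimedean multiplicative norm.  The library's \<^const>\<open>norm\<close>
  is constrained to real vector spaces, hence the separate constant.  Discs are the library's
  \<^const>\<open>cball\<close>, and topology and completeness are those of the underlying metric space.
\<close>

class nonarch_normed_field = field_char_0 + metric_space +
  fixes vnorm :: "'a \<Rightarrow> real"
  assumes dist_vnorm: "dist x y = vnorm (x - y)"
    and vnorm_mult: "vnorm (x * y) = vnorm x * vnorm y"
    and vnorm_ultrametric: "vnorm (x + y) \<le> max (vnorm x) (vnorm y)"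


section \<open>The field of \<open>p\<close>-adic complex numbers\<close>

text \<open>
  The \<open>p\<close>-adic norm on the rationals.  In \<^term>\<open>quotient_of x\<close> the first component is the
  numerator and the second one the (positive) denominator, in lowest terms.
\<close>

definition padic_norm :: "nat \<Rightarrow> rat \<Rightarrow> real" where
  "padic_norm p x =
     (if x = 0 then 0
      else real p powi (int (multiplicity (int p) (snd (quotient_of x)))
                      - int (multiplicity (int p) (fst (quotient_of x)))))"

text \<open>Completions and algebraic closures are formed inside a given ambient field.\<close>

definition is_completion_of :: "'a::metric_space set \<Rightarrow> 'a set \<Rightarrow> bool" where
  "is_completion_of S T \<longleftrightarrow> S \<subseteq> T \<and> complete T \<and> T \<subseteq> closure S"

definition is_subfield :: "'a::field set \<Rightarrow> bool" where
  "is_subfield K \<longleftrightarrow> 0 \<in> K \<and> 1 \<in> K \<and>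
     (\<forall>x\<in>K. \<forall>y\<in>K. x + y \<in> K \<and> x * y \<in> K) \<and> (\<forall>x\<in>K. - x \<in> K \<and> inverse x \<in> K)"

definition algebraic_over :: "'a::field set \<Rightarrow> 'a \<Rightarrow> bool" where
  "algebraic_over K x \<longleftrightarrow> (\<exists>q. q \<noteq> 0 \<and> (\<forall>i. coeff q i \<in> K) \<and> poly q x = 0)"

definition alg_closed_subfield :: "'a::field set \<Rightarrow> bool" where
  "alg_closed_subfield L \<longleftrightarrow> is_subfield L \<and>
     (\<forall>q. (\<forall>i. coeff q i \<in> L) \<and> degree q > 0 \<longrightarrow> (\<exists>x\<in>L. poly q x = 0))"

definition is_alg_closure_of :: "'a::field set \<Rightarrow> 'a set \<Rightarrow> bool" where
  "is_alg_closure_of K L \<longleftrightarrow>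
     is_subfield K \<and> K \<subseteq> L \<and> alg_closed_subfield L \<and> (\<forall>x\<in>L. algebraic_over K x)"

text \<open>
  The type \<open>'a\<close> is the field of \<open>p\<close>-adic complex numbers: its norm extends the \<open>p\<close>-adic norm on
  the rationals, and it is the completion of an algebraic closure \<open>L\<close> of the completion \<open>K\<close> of the
  rationals.  This determines \<open>'a\<close> up to isometric isomorphism.
\<close>

definition is_padic_complex_field :: "nat \<Rightarrow> 'a::nonarch_normed_field itself \<Rightarrow> bool" where
  "is_padic_complex_field p (_ :: 'a itself) \<longleftrightarrow>
     (\<forall>x. vnorm (of_rat x :: 'a) = padic_norm p x) \<and>
     (\<exists>K L :: 'a set. is_completion_of \<rat> K \<and> is_alg_closure_of K L \<and> is_completion_of L UNIV)"


section \<open>The projective line with the chordal metric\<close>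

datatype 'a proj_line = Aff 'a | Infty

fun chordal :: "'a::nonarch_normed_field proj_line \<Rightarrow> 'a proj_line \<Rightarrow> real" where
  "chordal (Aff z) (Aff w) = vnorm (z - w) / (max (vnorm z) 1 * max (vnorm w) 1)"
| "chordal (Aff z) Infty = 1 / max (vnorm z) 1"
| "chordal Infty (Aff w) = 1 / max (vnorm w) 1"
| "chordal Infty Infty = 0"

lemma vnorm_zero: "vnorm (0 :: 'a::nonarch_normed_field) = 0"
  by (metis diff_self dist_vnorm dist_self)

lemma vnorm_nonneg: "vnorm (x :: 'a::nonarch_normed_field) \<ge> 0"
  by (metis diff_zero dist_vnorm zero_le_dist)

lemma vnorm_eq_0: "vnorm (x :: 'a::nonarch_normed_field) = 0 \<longleftrightarrow> x = 0"
  by (metis diff_zero dist_eq_0_iff dist_vnorm)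

lemma vnorm_one: "vnorm (1 :: 'a::nonarch_normed_field) = 1"
  by (metis mult_cancel_right1 vnorm_eq_0 vnorm_mult zero_neq_one)

lemma vnorm_minus_commute: "vnorm (x - y :: 'a::nonarch_normed_field) = vnorm (y - x)"
  by (metis dist_commute dist_vnorm)

text \<open>
  The triangle inequality for \<^const>\<open>chordal\<close>, via homogeneous coordinates \<open>(x, y)\<close>: the chordal
  distance is the norm of the determinant of the coordinate vectors divided by the product of the
  maximum norms of these vectors.
\<close>

fun hcoord :: "'a::nonarch_normed_field proj_line \<Rightarrow> 'a \<times> 'a" where
  "hcoord (Aff z) = (z, 1)"
| "hcoord Infty = (1, 0)"

definition hnorm :: "'a::nonarch_normed_field \<times> 'a \<Rightarrow> real" where
  "hnorm u = max (vnorm (fst u)) (vnorm (snd u))"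

definition hdet :: "'a::nonarch_normed_field \<times> 'a \<Rightarrow> 'a \<times> 'a \<Rightarrow> 'a" where
  "hdet u v = fst u * snd v - fst v * snd u"

lemma chordal_hcoord:
  "chordal x y = vnorm (hdet (hcoord x) (hcoord y)) / (hnorm (hcoord x) * hnorm (hcoord y))"
  using vnorm_minus_commute[of 0 "1::'a"]
  by (cases x; cases y)
     (auto simp: hdet_def hnorm_def vnorm_zero vnorm_one)

lemma hnorm_hcoord_pos: "hnorm (hcoord x) > 0"
  by (cases x) (auto simp: hnorm_def vnorm_zero vnorm_one less_max_iff_disj)

lemma hdet_ultrametric:
  "vnorm (hdet u w) * hnorm v \<le> max (vnorm (hdet u v) * hnorm w) (vnorm (hdet v w) * hnorm u)"
proof -
  have fs: "hdet u w * fst v = hdet u v * fst w + hdet v w * fst u"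
    and sn: "hdet u w * snd v = hdet u v * snd w + hdet v w * snd u"
    by (simp_all add: hdet_def algebra_simps)
  have aux: "vnorm (a * x + b * y) \<le> max (vnorm a * X) (vnorm b * Y)"
    if "vnorm x \<le> X" "vnorm y \<le> Y" for a b x y :: 'a and X Y
  proof -
    have "vnorm a * vnorm x \<le> vnorm a * X" "vnorm b * vnorm y \<le> vnorm b * Y"
      using that by (auto intro!: mult_left_mono vnorm_nonneg)
    then show ?thesis
      using vnorm_ultrametric[of "a * x" "b * y"] by (auto simp: vnorm_mult)
  qed
  have "vnorm (hdet u w) * vnorm (fst v) \<le> max (vnorm (hdet u v) * hnorm w) (vnorm (hdet v w) * hnorm u)"
    unfolding vnorm_mult[symmetric] fs by (rule aux) (auto simp: hnorm_def)
  moreover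
  have "vnorm (hdet u w) * vnorm (snd v) \<le> max (vnorm (hdet u v) * hnorm w) (vnorm (hdet v w) * hnorm u)"
    unfolding vnorm_mult[symmetric] sn by (rule aux) (auto simp: hnorm_def)
  ultimately show ?thesis
    unfolding hnorm_def[of v] by (cases "vnorm (fst v) \<le> vnorm (snd v)") (simp_all only: max_absorb1 max_absorb2 linear not_le less_imp_le)
qed

lemma chordal_nonneg: "chordal x y \<ge> 0"
  by (cases x; cases y) (auto intro!: divide_nonneg_nonneg vnorm_nonneg mult_nonneg_nonneg)

lemma chordal_commute: "chordal x y = chordal y x"
  by (cases x; cases y) (auto simp: vnorm_minus_commute mult.commute)

lemma chordal_eq_0: "chordal x y = 0 \<longleftrightarrow> x = y"
  by (cases x; cases y) (auto simp: vnorm_eq_0 vnorm_zero max_def)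

lemma chordal_ultrametric: "chordal x z \<le> max (chordal x y) (chordal y z)"
proof -
  define a b c where "a = hnorm (hcoord x)" and "b = hnorm (hcoord y)" and "c = hnorm (hcoord z)"
  have pos: "a > 0" "b > 0" "c > 0"
    by (simp_all add: a_def b_def c_def hnorm_hcoord_pos)
  define r s t where "r = vnorm (hdet (hcoord x) (hcoord z))"
    and "s = vnorm (hdet (hcoord x) (hcoord y))" and "t = vnorm (hdet (hcoord y) (hcoord z))"
  have "r * b \<le> max (s * c) (t * a)"
    unfolding a_def b_def c_def r_def s_def t_def by (rule hdet_ultrametric)
  then have "r / (a * c) \<le> max (s / (a * b)) (t / (b * c))"
    using pos by (auto simp: le_max_iff_disj field_simps)
  then show ?thesis
    by (simp add: chordal_hcoord a_def b_def c_def r_def s_def t_def)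
qed

instantiation proj_line :: (nonarch_normed_field) metric_space
begin

definition dist_proj_line :: "'a proj_line \<Rightarrow> 'a proj_line \<Rightarrow> real" where
  "dist_proj_line = chordal"

definition uniformity_proj_line :: "('a proj_line \<times> 'a proj_line) filter" where
  "uniformity_proj_line = (INF e\<in>{0 <..}. principal {(x, y). dist x y < e})"

definition open_proj_line :: "'a proj_line set \<Rightarrow> bool" where
  "open_proj_line U \<longleftrightarrow> (\<forall>x\<in>U. eventually (\<lambda>(x', y). x' = x \<longrightarrow> y \<in> U) uniformity)"

instance
proof
  fix x y z :: "'a proj_line"
  show "dist x y = 0 \<longleftrightarrow> x = y"
    by (simp add: dist_proj_line_def chordal_eq_0)
  show "dist x y \<le> dist x z + dist y z"
    using chordal_ultrametric[of x y z] chordal_nonneg[of x z] chordal_nonneg[of y z]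
      chordal_commute[of z y]
    by (simp add: dist_proj_line_def)
qed (simp_all add: uniformity_proj_line_def open_proj_line_def)

end


section \<open>Fatou and Julia sets\<close>

definition equicontinuous_on :: "'a::metric_space set \<Rightarrow> ('a \<Rightarrow> 'b::metric_space) set \<Rightarrow> bool" where
  "equicontinuous_on U \<F> \<longleftrightarrow>
     (\<forall>x\<in>U. \<forall>\<epsilon>>0. \<exists>\<delta>>0. \<forall>F\<in>\<F>. \<forall>y\<in>U. dist x y < \<delta> \<longrightarrow> dist (F x) (F y) < \<epsilon>)"

definition Fatou :: "('a::metric_space \<Rightarrow> 'a) \<Rightarrow> 'a set" where
  "Fatou F = \<Union>{U. open U \<and> equicontinuous_on U (range (\<lambda>n. F ^^ n))}"

definition Julia :: "('a::metric_space \<Rightarrow> 'a) \<Rightarrow> 'a set" where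
  "Julia F = - Fatou F"

lemma Fatou_largest:
  shows "open (Fatou F)"
    and "equicontinuous_on (Fatou F) (range (\<lambda>n. F ^^ n))"
    and "\<And>U. open U \<Longrightarrow> equicontinuous_on U (range (\<lambda>n. F ^^ n)) \<Longrightarrow> U \<subseteq> Fatou F"
proof -
  show "equicontinuous_on (Fatou F) (range (\<lambda>n. F ^^ n))"
    unfolding equicontinuous_on_def
  proof (intro ballI allI impI)
    fix x and \<epsilon> :: real assume "x \<in> Fatou F" "\<epsilon> > 0"
    then obtain U where U: "open U" "equicontinuous_on U (range (\<lambda>n. F ^^ n))" "x \<in> U"
      by (auto simp: Fatou_def)
    obtain \<delta>1 where \<delta>1: "\<delta>1 > 0" "\<And>y. dist x y < \<delta>1 \<Longrightarrow> y \<in> U"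
      using U by (metis dist_commute open_dist)
    obtain \<delta>2 where \<delta>2: "\<delta>2 > 0"
      "\<And>G y. G \<in> range (\<lambda>n. F ^^ n) \<Longrightarrow> y \<in> U \<Longrightarrow> dist x y < \<delta>2 \<Longrightarrow> dist (G x) (G y) < \<epsilon>"
      using U \<open>\<epsilon> > 0\<close> unfolding equicontinuous_on_def by meson
    show "\<exists>\<delta>>0. \<forall>G\<in>range (\<lambda>n. F ^^ n). \<forall>y\<in>Fatou F. dist x y < \<delta> \<longrightarrow> dist (G x) (G y) < \<epsilon>"
      using \<delta>1 \<delta>2 by (intro exI[of _ "min \<delta>1 \<delta>2"]) auto
  qed
qed (auto simp: Fatou_def)


section \<open>Polynomial maps and J-stability\<close>

fun poly_map :: "'a::comm_semiring_0 poly \<Rightarrow> 'a proj_line \<Rightarrow> 'a proj_line" where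
  "poly_map f (Aff z) = Aff (poly f z)"
| "poly_map f Infty = Infty"

text \<open>
  The polynomials of degree \<open>d\<close>, with the topology pulled back along the coefficients from
  \<open>C\<^sup>\<times> \<times> C\<^sup>d\<close>; the factor with index \<open>d\<close> is the one for the leading coefficient.
\<close>

definition Poly_top :: "nat \<Rightarrow> 'a::nonarch_normed_field poly topology" where
  "Poly_top d =
     pullback_topology {f. degree f = d} (\<lambda>f. restrict (coeff f) {..d})
       (product_topology (\<lambda>i. if i = d then top_of_set (- {0}) else euclidean) {..d})"

lemma topspace_Poly_top: "d > 0 \<Longrightarrow> topspace (Poly_top d) = {f. degree f = d}"
  by (auto simp: Poly_top_def topspace_pullback_topology PiE_iff)

definition J_stable :: "nat \<Rightarrow> 'a::nonarch_normed_field poly \<Rightarrow> bool" where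
  "J_stable d f \<longleftrightarrow>
     (\<exists>U. openin (Poly_top d) U \<and> f \<in> U \<and>
        (\<forall>g\<in>U. \<exists>h. homeomorphic_map (top_of_set (Julia (poly_map f)))
                       (top_of_set (Julia (poly_map g))) h \<and>
                     (\<forall>x\<in>Julia (poly_map f). h (poly_map f x) = poly_map g (h x))))"

end

theory Submission
  imports Defs
begin

text \<open>
  By condition (4), \<open>B\<close> and its complement are open, and the complement is forward invariant and
  avoids a disc, so a Montel argument puts it into the Fatou set; on the other hand \<open>f\<close> stretches
  all distances up to some \<open>\<rho>\<close> near a point \<open>z\<close> of \<open>B\<close> by the factor \<open>\<bar>f'(z)\<bar> \<ge> \<mu>\<close>.  Hence
  the Julia set consists of the points whose orbit stays in \<open>B\<close>.  The hypotheses hold with the same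
  \<open>B\<close>, \<open>\<rho>\<close> and \<open>\<mu>\<close> for every \<open>g\<close> close to \<open>f\<close>, and even \<open>\<bar>g'\<bar> = \<bar>f'\<bar>\<close> on \<open>B\<close> by the ultrametric
  inequality.  An \<open>f\<close>-orbit in \<open>B\<close> is a pseudo-orbit of \<open>g\<close>, shadowed by a unique \<open>g\<close>-orbit, which
  gives the conjugacy; it turns out to be an isometry.
\<close>

section \<open>Shadowing for expanding maps of ultrametric spaces\<close>

text \<open>The factor \<open>s\<close> is a parameter instead of being derived from
  \<open>f\<close>, so that a map and its perturbation can share it. One radius \<rho> serves as the
  scale of exact expansion, the margin of \<open>B\<close> and the error allowed for
  pseudo-orbits.\<close>

locale expanding_map =
  fixes B :: "'a::metric_space set" and \<rho> :: real and s :: "'a \<Rightarrow> real" and \<mu> :: real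
    and f :: "'a \<Rightarrow> 'a"
  assumes complete_UNIV: "complete (UNIV :: 'a set)"
    and ultrametric: "\<And>x y z :: 'a. dist x z \<le> max (dist x y) (dist y z)"
    and \<rho>_pos: "\<rho> > 0"
    and \<mu>_gt_1: "\<mu> > 1"
    and cball_subset: "z \<in> B \<Longrightarrow> cball z \<rho> \<subseteq> B"
    and s_ge: "z \<in> B \<Longrightarrow> \<mu> \<le> s z"
    and continuous: "continuous_on UNIV f"
    and dist_image: "\<lbrakk>z \<in> B; x \<in> cball z \<rho>; y \<in> cball z \<rho>\<rbrakk> \<Longrightarrow> dist (f x) (f y) = s z * dist x y"
    and image_cball: "z \<in> B \<Longrightarrow> cball (f z) \<rho> \<subseteq> f ` cball z \<rho>"

text \<open>The largest forward invariant subset of \<open>B\<close>; for the polynomials below it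
  turns out to be the Julia set.\<close>

definition trapped :: "'a set \<Rightarrow> ('a \<Rightarrow> 'a) \<Rightarrow> 'a set" where
  "trapped B f = {z. \<forall>n. (f ^^ n) z \<in> B}"

lemma trapped_image: "z \<in> trapped B f \<Longrightarrow> f z \<in> trapped B f"
  unfolding trapped_def mem_Collect_eq by (metis funpow_Suc_right comp_apply)

lemma trapped_subset: "z \<in> trapped B f \<Longrightarrow> z \<in> B"
  unfolding trapped_def by (metis (mono_tags) funpow_0 mem_Collect_eq)

context expanding_map
begin

text \<open>Two orbits in the same balls separate by a factor of at least \<mu> per step, yet end
  within \<rho> of each other, because an ultrametric ball of radius \<rho> has diameter at most
  \<rho>. The finite form yields both the uniqueness of shadows and the convergence of finite
  shadows.\<close>

lemma dist_shadows:
  assumes "\<And>k. k < n \<Longrightarrow> z k \<in> B"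
    and "\<And>k. k \<le> n \<Longrightarrow> dist (z k) ((f ^^ k) x) \<le> \<rho>"
    and "\<And>k. k \<le> n \<Longrightarrow> dist (z k) ((f ^^ k) y) \<le> \<rho>"
  shows "dist x y * \<mu> ^ n \<le> \<rho>"
proof -
  have "dist x y * \<mu> ^ k \<le> dist ((f ^^ k) x) ((f ^^ k) y)" if "k \<le> n" for k
    using that
  proof (induction k)
    case (Suc k)
    let ?x = "(f ^^ k) x" and ?y = "(f ^^ k) y"
    have "dist x y * \<mu> ^ Suc k = \<mu> * (dist x y * \<mu> ^ k)"
      by simp
    also have "\<dots> \<le> s (z k) * dist ?x ?y"
      using Suc assms(1)[of k] s_ge[of "z k"] \<mu>_gt_1 by (intro mult_mono) auto
    also have "\<dots> = dist (f ?x) (f ?y)"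
      using Suc.prems assms by (intro dist_image[symmetric]) auto
    finally show ?case
      by simp
  qed simp
  also have "dist ((f ^^ n) x) ((f ^^ n) y) \<le> \<rho>"
    using ultrametric[of "(f ^^ n) x" "(f ^^ n) y" "z n"] assms(2,3)[of n]
    by (simp add: dist_commute)
  finally show ?thesis
    by simp
qed

lemma shadows_unique:
  assumes "\<And>k. z k \<in> B"
    and "\<And>k. dist (z k) ((f ^^ k) x) \<le> \<rho>"
    and "\<And>k. dist (z k) ((f ^^ k) y) \<le> \<rho>"
  shows "x = y"
proof (rule ccontr)
  assume "x \<noteq> y"
  then obtain n where "\<mu> ^ n > \<rho> / dist x y"
    using real_arch_pow[OF \<mu>_gt_1] by blast
  then have "dist x y * \<mu> ^ n > \<rho>"
    using \<open>x \<noteq> y\<close> by (simp add: field_simps)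
  with dist_shadows[of n z x y] assms show False
    by force
qed

text \<open>Shadows are pulled back from the end of the pseudo-orbit: a shadow \<open>y\<close> of
  the tail lies within \<rho> of \<open>f (z 0)\<close> and so has a preimage in the ball around
  \<open>z 0\<close>. The ultrametric inequality keeps errors from accumulating.\<close>

lemma finite_shadow:
  assumes "\<And>k. z k \<in> B" "\<And>k. dist (f (z k)) (z (Suc k)) \<le> \<rho>"
  shows "\<exists>x. \<forall>k\<le>n. dist (z k) ((f ^^ k) x) \<le> \<rho>"
  using assms
proof (induction n arbitrary: z)
  case 0
  then show ?case
    using \<rho>_pos by (intro exI[of _ "z 0"]) auto
next
  case (Suc n)
  obtain y where y: "\<And>k. k \<le> n \<Longrightarrow> dist (z (Suc k)) ((f ^^ k) y) \<le> \<rho>"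
    using Suc.IH[of "\<lambda>k. z (Suc k)"] Suc.prems by blast
  have "dist (f (z 0)) y \<le> \<rho>"
    using ultrametric[of "f (z 0)" y "z (Suc 0)"] Suc.prems(2)[of 0] y[of 0] by simp
  then obtain x where x: "dist (z 0) x \<le> \<rho>" "f x = y"
    using image_cball[OF Suc.prems(1)[of 0]] by auto
  have "dist (z k) ((f ^^ k) x) \<le> \<rho>" if "k \<le> Suc n" for k
    using that x y by (cases k) (auto simp del: funpow.simps simp: funpow_Suc_right)
  then show ?case
    by blast
qed

lemma continuous_funpow: "continuous_on UNIV (f ^^ n)"
proof (induction n)
  case (Suc n)
  then show ?case
    using continuous_on_compose[OF Suc.IH continuous_on_subset[OF continuous]] by simp
qed (simp add: continuous_on_id)

text \<open>Points shadowing the first \<open>N\<close> steps are within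
  \<open>\<rho> / \<mu> ^ N\<close> of each other, so finite shadows form a Cauchy sequence, and the
  closed condition passes to the limit.\<close>

lemma shadow:
  assumes "\<And>k. z k \<in> B" "\<And>k. dist (f (z k)) (z (Suc k)) \<le> \<rho>"
  obtains x where "\<And>k. dist (z k) ((f ^^ k) x) \<le> \<rho>"
proof -
  obtain X where X: "\<And>n k. k \<le> n \<Longrightarrow> dist (z k) ((f ^^ k) (X n)) \<le> \<rho>"
    using finite_shadow[of z, OF assms] by metis
  have "Cauchy X"
  proof (rule metric_CauchyI)
    fix e :: real
    assume "e > 0"
    obtain N where N: "\<mu> ^ N > \<rho> / e"
      using real_arch_pow[OF \<mu>_gt_1] by blast
    have "dist (X m) (X n) < e" if "m \<ge> N" "n \<ge> N" for m n
    proof -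
      have "dist (X m) (X n) * \<mu> ^ N \<le> \<rho>"
        using that by (intro dist_shadows[of N z] assms X) auto
      also have "\<rho> < e * \<mu> ^ N"
        using N \<open>e > 0\<close> by (simp add: field_simps)
      finally show ?thesis
        using \<mu>_gt_1 by simp
    qed
    then show "\<exists>M. \<forall>m\<ge>M. \<forall>n\<ge>M. dist (X m) (X n) < e"
      by blast
  qed
  then obtain x where x: "X \<longlonglongrightarrow> x"
    using complete_UNIV unfolding complete_def by blast
  have "dist (z k) ((f ^^ k) x) \<le> \<rho>" for k
  proof -
    have "(\<lambda>n. (f ^^ k) (X n)) \<longlonglongrightarrow> (f ^^ k) x"
      using continuous_funpow[of k] x
      by (intro continuous_on_tendsto_compose[of UNIV "f ^^ k"]) auto
    then have "(\<lambda>n. dist (z k) ((f ^^ k) (X n))) \<longlonglongrightarrow> dist (z k) ((f ^^ k) x)"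
      by (intro tendsto_intros)
    then show ?thesis
      using X by (intro LIMSEQ_le_const2) (auto intro: exI[of _ k])
  qed
  with that show ?thesis
    by blast
qed

end

text \<open>
  The conjugacy maps \<open>z\<close> to the point whose \<open>g\<close>-orbit shadows the \<open>f\<close>-orbit of \<open>z\<close>.  It is
  isometric because \<open>f\<close> and \<open>g\<close> are scaled by the same factor \<open>s\<close> until two orbits have separated
  by more than \<open>\<rho>\<close>, and beyond that distance a displacement by at most \<open>\<rho>\<close> is invisible.
\<close>

lemma isometric_conjugacy:
  assumes "expanding_map B \<rho> s \<mu> f" "expanding_map B \<rho> s \<mu> g"
    and close: "\<And>z. z \<in> B \<Longrightarrow> dist (f z) (g z) \<le> \<rho>"
  shows "\<exists>h. bij_betw h (trapped B f) (trapped B g) \<and>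
    (\<forall>z\<in>trapped B f. h (f z) = g (h z) \<and> dist z (h z) \<le> \<rho>) \<and>
    (\<forall>z\<in>trapped B f. \<forall>w\<in>trapped B f. dist (h z) (h w) = dist z w)"
proof -
  interpret F: expanding_map B \<rho> s \<mu> f by fact
  interpret G: expanding_map B \<rho> s \<mu> g by fact
  have "\<exists>x. \<forall>n. dist ((f ^^ n) z) ((g ^^ n) x) \<le> \<rho>" if z: "z \<in> trapped B f" for z
    using G.shadow[of "\<lambda>n. (f ^^ n) z"] z close
    by (metis (mono_tags, lifting) dist_commute comp_apply funpow.simps(2) mem_Collect_eq trapped_def)
  then obtain h where h: "\<And>z n. z \<in> trapped B f \<Longrightarrow> dist ((f ^^ n) z) ((g ^^ n) (h z)) \<le> \<rho>"
    by metis
  have fz: "(f ^^ n) z \<in> B" if "z \<in> trapped B f" for z n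
    using that by (simp add: trapped_def)
  have uniq: "h z = x"
    if "z \<in> trapped B f" "\<And>n. dist ((f ^^ n) z) ((g ^^ n) x) \<le> \<rho>" for z x
    using that h fz by (intro G.shadows_unique[of "\<lambda>n. (f ^^ n) z"]) auto
  have h_in: "h z \<in> trapped B g" if z: "z \<in> trapped B f" for z
    using h[OF z] fz[OF z] F.cball_subset unfolding trapped_def by (auto simp: subset_iff)
  \<comment> \<open>Shadowing orbits still shadow after a shift by one step, so uniqueness
    identifies the two points.\<close>
  have equiv: "h (f z) = g (h z)" if z: "z \<in> trapped B f" for z
  proof (rule uniq)
    show "dist ((f ^^ n) (f z)) ((g ^^ n) (g (h z))) \<le> \<rho>" for n
      using h[OF z, of "Suc n"] by (simp add: funpow_swap1)
  qed (use trapped_image[OF z] in auto)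
  have close_h: "dist z (h z) \<le> \<rho>" if z: "z \<in> trapped B f" for z
    using h[OF z, of 0] by simp
  have isom_far: "dist (h z) (h w) = dist z w"
    if zw: "z \<in> trapped B f" "w \<in> trapped B f" and "dist z w > \<rho>" for z w
  proof (rule antisym)
    have *: "dist z (h w) \<le> dist z w" "dist z w \<le> dist z (h w)"
      using F.ultrametric[of z "h w" w] F.ultrametric[of z w "h w"] close_h[OF zw(2)] \<open>dist z w > \<rho>\<close>
      by (auto simp: dist_commute)
    show "dist (h z) (h w) \<le> dist z w" "dist z w \<le> dist (h z) (h w)"
      using F.ultrametric[of "h z" "h w" z] F.ultrametric[of z "h w" "h z"] close_h[OF zw(1)]
        \<open>dist z w > \<rho>\<close> * by (auto simp: dist_commute)
  qed
  \<comment> \<open>The last assumption says that the orbits separate by more than \<rho> within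
    \<open>n\<close> steps. It passes from \<open>z\<close>, \<open>w\<close> with
    \<open>Suc n\<close> to their images with \<open>n\<close> because \<open>s z\<close> is at
    least \<mu>.\<close>
  have isom_step: "dist (h z) (h w) = dist z w"
    if "z \<in> trapped B f" "w \<in> trapped B f" "dist z w * \<mu> ^ n > \<rho>" for z w n
    using that
  proof (induction n arbitrary: z w)
    case 0
    then show ?case
      using isom_far by simp
  next
    case (Suc n)
    show ?case
    proof (cases "dist z w > \<rho>")
      case True
      then show ?thesis
        using Suc.prems isom_far by simp
    next
      case False
      have z: "z \<in> B"
        using Suc.prems(1) by (rule trapped_subset)
      have fzw: "dist (f z) (f w) = s z * dist z w"
        using F.dist_image[OF z, of z w] False F.\<rho>_pos by simp
      have "\<rho> < \<mu> * dist z w * \<mu> ^ n"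
        using Suc.prems by (simp add: mult_ac)
      also have "\<dots> \<le> dist (f z) (f w) * \<mu> ^ n"
        unfolding fzw using F.s_ge[OF z] F.\<mu>_gt_1 by (intro mult_right_mono) auto
      finally have "dist (h (f z)) (h (f w)) = dist (f z) (f w)"
        using Suc.prems by (intro Suc.IH trapped_image) simp_all
      \<comment> \<open>Now \<open>h z\<close> and \<open>h w\<close> both lie in the ball around
        \<open>z\<close>, where \<open>g\<close> scales by the same factor \<open>s z\<close> as
        \<open>f\<close>.\<close>
      moreover have "dist z (h w) \<le> \<rho>"
        using F.ultrametric[of z "h w" w] False close_h[OF Suc.prems(2)] by simp
      then have "dist (g (h z)) (g (h w)) = s z * dist (h z) (h w)"
        using close_h[OF Suc.prems(1)] by (intro G.dist_image[OF z]) auto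
      ultimately have "s z * dist (h z) (h w) = s z * dist z w"
        using Suc.prems equiv fzw by simp
      then show ?thesis
        using F.s_ge[OF z] F.\<mu>_gt_1 by simp
    qed
  qed
  have isom: "dist (h z) (h w) = dist z w"
    if zw: "z \<in> trapped B f" "w \<in> trapped B f" for z w
  proof (cases "z = w")
    case False
    obtain n where "\<mu> ^ n > \<rho> / dist z w"
      using real_arch_pow[OF F.\<mu>_gt_1] by blast
    then show ?thesis
      using False zw by (intro isom_step[of z w n]) (simp_all add: field_simps)
  qed simp
  have surj: "\<exists>z\<in>trapped B f. h z = w" if w: "w \<in> trapped B g" for w
  proof -
    have gw: "(g ^^ n) w \<in> B" for n
      using w by (simp add: trapped_def)
    \<comment> \<open>Shadowing is symmetric in the two orbits, so a preimage of \<open>w\<close>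
      arises by shadowing its \<open>g\<close>-orbit with an \<open>f\<close>-orbit.\<close>
    obtain z where z: "\<And>n. dist ((g ^^ n) w) ((f ^^ n) z) \<le> \<rho>"
      using F.shadow[of "\<lambda>n. (g ^^ n) w"] gw close by auto
    have "z \<in> trapped B f"
      using z gw F.cball_subset unfolding trapped_def by (auto simp: subset_iff)
    moreover from this have "h z = w"
      using z by (intro uniq) (auto simp: dist_commute)
    ultimately show ?thesis
      by blast
  qed
  have "bij_betw h (trapped B f) (trapped B g)"
    unfolding bij_betw_def inj_on_def
  proof (intro conjI ballI impI)
    show "z = w" if "z \<in> trapped B f" "w \<in> trapped B f" "h z = h w" for z w
      using isom[OF that(1,2)] that(3) by simp
  qed (use h_in surj in auto)
  with equiv close_h isom show ?thesis
    by blast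
qed


section \<open>The ultrametric norm\<close>

lemma vnorm_minus: "vnorm (- x :: 'a::nonarch_normed_field) = vnorm x"
  using vnorm_minus_commute[of x 0] by simp

lemma vnorm_diff_ultrametric: "vnorm (x - y :: 'a::nonarch_normed_field) \<le> max (vnorm x) (vnorm y)"
  using vnorm_ultrametric[of x "- y"] by (simp add: vnorm_minus)

lemma vnorm_power: "vnorm (x ^ n :: 'a::nonarch_normed_field) = vnorm x ^ n"
  by (induction n) (simp_all add: vnorm_one vnorm_mult)

lemma vnorm_divide: "vnorm (x / y :: 'a::nonarch_normed_field) = vnorm x / vnorm y"
proof (cases "y = 0")
  case False
  then have "vnorm (x / y) * vnorm y = vnorm x"
    by (simp flip: vnorm_mult)
  then show ?thesis
    using False by (simp add: field_simps vnorm_eq_0)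
qed (simp add: vnorm_zero)

text \<open>The isosceles triangle principle, the source of most exact equalities of norms
  below.\<close>

lemma vnorm_eq_of_diff_less:
  "vnorm (x - y :: 'a::nonarch_normed_field) < vnorm x \<Longrightarrow> vnorm y = vnorm x"
  using vnorm_diff_ultrametric[of x "x - y"] vnorm_ultrametric[of "x - y" y]
  by simp

lemma dist_ultrametric: "dist x (z :: 'a::nonarch_normed_field) \<le> max (dist x y) (dist y z)"
  using vnorm_ultrametric[of "x - y" "y - z"] by (simp add: dist_vnorm)

lemma vnorm_sum_le:
  assumes "\<And>i. i \<in> A \<Longrightarrow> vnorm (u i :: 'a::nonarch_normed_field) \<le> C" "0 \<le> C"
  shows "vnorm (sum u A) \<le> C"
  using assms
proof (induction A rule: infinite_finite_induct)
  case (insert x F)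
  then show ?case
    using vnorm_ultrametric[of "u x" "sum u F"] by force
qed (simp_all add: vnorm_zero)


section \<open>Estimates for polynomials\<close>

text \<open>A bound on the Gauss norm for the disc of radius \<open>m\<close>. As a predicate it
  avoids a maximum over the coefficients and suits induction over \<open>pCons\<close>.\<close>

definition gauss_le :: "real \<Rightarrow> 'a::nonarch_normed_field poly \<Rightarrow> real \<Rightarrow> bool" where
  "gauss_le m q C \<longleftrightarrow> (\<forall>i. vnorm (coeff q i) * m ^ i \<le> C)"

lemma gauss_le_nonneg: "gauss_le m q C \<Longrightarrow> 0 \<le> C"
  unfolding gauss_le_def
  by (metis mult.right_neutral order_trans power_0 vnorm_nonneg)

lemma gauss_le_mono: "gauss_le m q C \<Longrightarrow> C \<le> C' \<Longrightarrow> gauss_le m q C'"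
  unfolding gauss_le_def by (meson order_trans)

lemma gauss_le_add:
  assumes "0 \<le> m" "gauss_le m q C" "gauss_le m r C"
  shows "gauss_le m (q + r) C"
  unfolding gauss_le_def
proof
  fix i
  have "vnorm (coeff (q + r) i) * m ^ i \<le> max (vnorm (coeff q i)) (vnorm (coeff r i)) * m ^ i"
    using assms(1) by (intro mult_right_mono) (simp_all add: vnorm_ultrametric)
  also have "\<dots> \<le> C"
    using assms(2,3) unfolding gauss_le_def max_def by auto
  finally show "vnorm (coeff (q + r) i) * m ^ i \<le> C" .
qed

lemma gauss_le_exists:
  assumes "0 \<le> m"
  obtains C where "gauss_le m q C"
proof
  show "gauss_le m q (\<Sum>i\<le>degree q. vnorm (coeff q i) * m ^ i)"
    unfolding gauss_le_def
  proof
    fix i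
    show "vnorm (coeff q i) * m ^ i \<le> (\<Sum>i\<le>degree q. vnorm (coeff q i) * m ^ i)"
    proof (cases "i \<le> degree q")
      case True
      then show ?thesis
        using assms by (intro member_le_sum) (auto simp: vnorm_nonneg)
    next
      case False
      then show ?thesis
        using assms by (simp add: coeff_eq_0 vnorm_zero sum_nonneg vnorm_nonneg)
    qed
  qed
qed

text \<open>The induction step for the following estimates: dropping the constant coefficient gains
  a factor \<open>m\<close>, which pays for the multiplication by \<open>x\<close> in Horner's
  scheme.\<close>

lemma gauss_le_pConsD:
  assumes "1 \<le> m" "gauss_le m (pCons a q) C"
  shows "vnorm a \<le> C" "gauss_le m q (C / m)"
proof -
  show "vnorm a \<le> C"
    using assms(2) unfolding gauss_le_def by (metis coeff_pCons_0 mult.right_neutral power_0)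
  show "gauss_le m q (C / m)"
    unfolding gauss_le_def
  proof
    fix i
    have "vnorm (coeff q i) * m ^ Suc i \<le> C"
      using assms(2) unfolding gauss_le_def by (metis coeff_pCons_Suc)
    then show "vnorm (coeff q i) * m ^ i \<le> C / m"
      using assms(1) by (simp add: field_simps)
  qed
qed

lemma vnorm_poly_le:
  assumes "1 \<le> m" "gauss_le m q C" "vnorm x \<le> m"
  shows "vnorm (poly q x) \<le> C"
  using assms(2)
proof (induction q arbitrary: C)
  case (pCons a q)
  have "vnorm x * vnorm (poly q x) \<le> m * (C / m)"
    using assms(1,3) gauss_le_pConsD(2)[OF assms(1) pCons.prems]
    by (intro mult_mono pCons.IH) (auto simp: vnorm_nonneg)
  then show ?case
    using assms(1) gauss_le_pConsD(1)[OF assms(1) pCons.prems]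
      vnorm_ultrametric[of a "x * poly q x"] by (simp add: vnorm_mult)
qed (auto simp: vnorm_zero dest: gauss_le_nonneg)

lemma vnorm_poly_diff_le:
  assumes m: "1 \<le> m" and q: "gauss_le m q C" and x: "vnorm x \<le> m" and y: "vnorm y \<le> m"
  shows "vnorm (poly q x - poly q y) \<le> C * vnorm (x - y)"
  using q
proof (induction q arbitrary: C)
  case (pCons a q)
  note q = gauss_le_pConsD(2)[OF m pCons.prems]
  have "0 \<le> C" and Cm: "C / m \<le> C"
    using gauss_le_nonneg[OF pCons.prems] m by (auto simp: divide_le_eq mult_le_cancel_left1)
  have "vnorm x * vnorm (poly q x - poly q y) \<le> m * (C / m * vnorm (x - y))"
    using m x by (intro mult_mono pCons.IH q) (auto simp: vnorm_nonneg)
  moreover have "vnorm (poly q y) * vnorm (x - y) \<le> C * vnorm (x - y)"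
    using vnorm_poly_le[OF m q y] Cm by (intro mult_right_mono) (auto simp: vnorm_nonneg)
  moreover have "poly (pCons a q) x - poly (pCons a q) y
      = x * (poly q x - poly q y) + poly q y * (x - y)"
    by (simp add: algebra_simps)
  ultimately show ?case
    using vnorm_ultrametric[of "x * (poly q x - poly q y)" "poly q y * (x - y)"] m
    by (simp add: vnorm_mult)
qed (auto simp: vnorm_zero vnorm_nonneg dest: gauss_le_nonneg)

lemma vnorm_poly_pderiv_le:
  assumes m: "1 \<le> m" and q: "gauss_le m q C" and x: "vnorm x \<le> m"
  shows "vnorm (poly (pderiv q) x) \<le> C"
  using q
proof (induction q arbitrary: C)
  case (pCons a q)
  note q = gauss_le_pConsD(2)[OF m pCons.prems]
  have Cm: "C / m \<le> C"
    using gauss_le_nonneg[OF pCons.prems] m by (auto simp: divide_le_eq mult_le_cancel_left1)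
  have "vnorm x * vnorm (poly (pderiv q) x) \<le> m * (C / m)"
    using m x by (intro mult_mono pCons.IH q) (auto simp: vnorm_nonneg)
  then show ?case
    using vnorm_ultrametric[of "poly q x" "x * poly (pderiv q) x"] m vnorm_poly_le[OF m q x] Cm
    by (simp add: vnorm_mult pderiv_pCons)
qed (auto simp: vnorm_zero dest: gauss_le_nonneg)

text \<open>A second order Taylor estimate with the derivative taken at the centre of a ball
  containing \<open>x\<close> and \<open>y\<close>, so that a single factor governs the whole
  ball.\<close>

lemma vnorm_poly_linear_approx_le:
  assumes m: "1 \<le> m" and q: "gauss_le m q C"
    and x: "vnorm x \<le> m" and y: "vnorm y \<le> m" and z: "vnorm z \<le> m"
    and xz: "vnorm (x - z) \<le> r" and yz: "vnorm (y - z) \<le> r"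
  shows "vnorm (poly q x - poly q y - poly (pderiv q) z * (x - y)) \<le> C * r * vnorm (x - y)"
  using q
proof (induction q arbitrary: C)
  case 0
  have "0 \<le> r"
    using xz vnorm_nonneg order_trans by blast
  then show ?case
    using gauss_le_nonneg[OF 0] by (simp add: vnorm_zero vnorm_nonneg)
next
  case (pCons a q)
  note q = gauss_le_pConsD(2)[OF m pCons.prems]
  let ?D = "poly q x - poly q y - poly (pderiv q) z * (x - y)"
  have "0 \<le> C"
    by (rule gauss_le_nonneg[OF pCons.prems])
  then have Cm: "C / m \<le> C" "0 \<le> C / m"
    using m by (auto simp: divide_le_eq mult_le_cancel_left1)
  have r: "0 \<le> r"
    using xz vnorm_nonneg order_trans by blast
  have "vnorm z * vnorm ?D \<le> m * (C / m * r * vnorm (x - y))"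
    using m z by (intro mult_mono pCons.IH q) (auto simp: vnorm_nonneg)
  then have 1: "vnorm (z * ?D) \<le> C * r * vnorm (x - y)"
    using m by (simp add: vnorm_mult)
  have "vnorm (x - z) * vnorm (poly q x - poly q y) \<le> r * (C / m * vnorm (x - y))"
    using r by (intro mult_mono xz vnorm_poly_diff_le[OF m q x y]) (auto simp: vnorm_nonneg)
  also have "\<dots> \<le> r * (C * vnorm (x - y))"
    using r Cm by (intro mult_left_mono mult_right_mono) (auto simp: vnorm_nonneg)
  finally have 2: "vnorm ((x - z) * (poly q x - poly q y)) \<le> C * r * vnorm (x - y)"
    by (simp add: vnorm_mult mult_ac)
  have "vnorm (poly q y - poly q z) \<le> C / m * vnorm (y - z)"
    by (rule vnorm_poly_diff_le[OF m q y z])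
  also have "\<dots> \<le> C * r"
    using Cm yz \<open>0 \<le> C\<close> by (intro mult_mono) (auto simp: vnorm_nonneg)
  finally have "vnorm (poly q y - poly q z) * vnorm (x - y) \<le> C * r * vnorm (x - y)"
    by (intro mult_right_mono vnorm_nonneg)
  then have 3: "vnorm ((poly q y - poly q z) * (x - y)) \<le> C * r * vnorm (x - y)"
    by (simp add: vnorm_mult)
  \<comment> \<open>By the product rule, the error splits into a term covered by the induction
    hypothesis and two products of differences.\<close>
  have "poly (pCons a q) x - poly (pCons a q) y - poly (pderiv (pCons a q)) z * (x - y)
      = z * ?D + (x - z) * (poly q x - poly q y) + (poly q y - poly q z) * (x - y)"
    by (simp add: pderiv_pCons algebra_simps)
  then show ?case
    using 1 2 3 vnorm_ultrametric[of "z * ?D" "(x - z) * (poly q x - poly q y)"]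
      vnorm_ultrametric[of "z * ?D + (x - z) * (poly q x - poly q y)"
        "(poly q y - poly q z) * (x - y)"]
    by simp
qed

lemma poly_Lipschitz_on_cball:
  fixes q :: "'a::nonarch_normed_field poly"
  obtains C where "C > 0"
    and "\<And>x y. dist a x \<le> r \<Longrightarrow> dist a y \<le> r \<Longrightarrow> dist (poly q x) (poly q y) \<le> C * dist x y"
proof -
  define m where "m = Max {1, vnorm a, r}"
  have m: "1 \<le> m"
    by (simp add: m_def)
  have le_m: "vnorm x \<le> m" if "dist a x \<le> r" for x
    using that vnorm_diff_ultrametric[of a "a - x"] by (auto simp: m_def dist_vnorm max_def split: if_splits)
  obtain C where C: "gauss_le m q C"
    using gauss_le_exists m by (metis order_trans zero_le_one)
  have "dist (poly q x) (poly q y) \<le> (C + 1) * dist x y" if "dist a x \<le> r" "dist a y \<le> r" for x y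
    using vnorm_poly_diff_le[OF m gauss_le_mono[OF C] le_m[OF that(1)] le_m[OF that(2)], of "C + 1"]
    by (simp add: dist_vnorm)
  then show ?thesis
    using that[of "C + 1"] gauss_le_nonneg[OF C] by simp
qed

lemma continuous_on_poly_nonarch:
  "continuous_on S (poly (q :: 'a::nonarch_normed_field poly))"
  unfolding continuous_on_iff
proof (intro ballI allI impI)
  fix a :: 'a and e :: real
  assume "e > 0"
  obtain C where C: "C > 0" "\<And>x y. dist a x \<le> 1 \<Longrightarrow> dist a y \<le> 1 \<Longrightarrow> dist (poly q x) (poly q y) \<le> C * dist x y"
    using poly_Lipschitz_on_cball[of a 1] by blast
  have "dist (poly q x) (poly q a) < e" if "dist x a < min 1 (e / C)" for x
  proof -
    have "dist (poly q x) (poly q a) \<le> C * dist x a"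
      using that by (intro C) (auto simp: dist_commute)
    also have "\<dots> < e"
      using that C(1) by (simp add: field_simps)
    finally show ?thesis .
  qed
  then show "\<exists>d>0. \<forall>x\<in>S. dist x a < d \<longrightarrow> dist (poly q x) (poly q a) < e"
    using \<open>e > 0\<close> C(1) by (intro exI[of _ "min 1 (e / C)"]) auto
qed

text \<open>By \<open>big\<close>, the leading term strictly exceeds the sum of the others, which
  the ultrametric inequality bounds by \<open>C * vnorm z ^ (d - 1)\<close>.\<close>

lemma vnorm_poly_eq_lead:
  assumes "degree q = d" "0 < d" "1 < vnorm z"
    and le: "\<And>i. i < d \<Longrightarrow> vnorm (coeff q i) \<le> C"
    and big: "C < vnorm (coeff q d) * vnorm z"
  shows "vnorm (poly q z) = vnorm (coeff q d) * vnorm z ^ d"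
proof -
  let ?l = "coeff q d * z ^ d"
  let ?t = "\<Sum>i<d. coeff q i * z ^ i"
  have "poly q z = ?t + ?l"
    unfolding poly_altdef assms(1) lessThan_Suc_atMost[symmetric] by simp
  have "0 \<le> C"
    using le[OF assms(2)] vnorm_nonneg order_trans by blast
  have "vnorm ?t \<le> C * vnorm z ^ (d - 1)"
  proof (rule vnorm_sum_le)
    fix i
    assume "i \<in> {..<d}"
    then show "vnorm (coeff q i * z ^ i) \<le> C * vnorm z ^ (d - 1)"
      unfolding vnorm_mult vnorm_power using assms(3) \<open>0 \<le> C\<close>
      by (intro mult_mono le power_increasing) (auto simp: vnorm_nonneg)
  qed (use \<open>0 \<le> C\<close> in \<open>simp add: vnorm_nonneg\<close>)
  also have "\<dots> < vnorm (coeff q d) * vnorm z * vnorm z ^ (d - 1)"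
    using big assms(3) by (intro mult_strict_right_mono) auto
  also have "\<dots> = vnorm ?l"
    using assms(2) by (cases d) (simp_all add: vnorm_mult vnorm_power)
  finally have "vnorm (?l - poly q z) < vnorm ?l"
    by (simp add: \<open>poly q z = ?t + ?l\<close> vnorm_minus)
  then show ?thesis
    using vnorm_eq_of_diff_less[of ?l "poly q z"] by (simp add: vnorm_mult vnorm_power)
qed

section \<open>Elements of small norm\<close>

lemma padic_norm_self:
  assumes "prime p"
  shows "padic_norm p (of_nat p) = 1 / real p"
proof -
  have "quotient_of (of_nat p) = (int p, 1)"
    using quotient_of_int[of "int p"] by simp
  moreover have "prime (int p)"
    using assms by simp
  ultimately show ?thesis
    using assms by (simp add: padic_norm_def multiplicity_self not_prime_unit power_int_minus
        field_simps prime_gt_0_nat)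
qed

text \<open>Powers of \<open>p\<close> tend to 0. This provides other points arbitrarily close to a
  given one, as required for refuting equicontinuity.\<close>

lemma small_element_exists:
  assumes p: "prime p" and padic: "\<And>x. vnorm (of_rat x :: 'a::nonarch_normed_field) = padic_norm p x"
    and "e > 0"
  obtains x :: "'a::nonarch_normed_field" where "x \<noteq> 0" "vnorm x < e"
proof -
  have "vnorm (of_nat p :: 'a) = 1 / real p"
    using padic[of "of_nat p"] padic_norm_self[OF p] by simp
  moreover have "1 / real p < 1"
    using prime_gt_1_nat[OF p] by simp
  ultimately obtain n where "vnorm (of_nat p :: 'a) ^ n < e"
    using real_arch_pow_inv[OF \<open>e > 0\<close>] by metis
  then show ?thesis
    using that[of "of_nat p ^ n"] p by (simp add: vnorm_power prime_gt_0_nat)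
qed


section \<open>Polynomials without zeros in a disc\<close>

lemma coeff_in_pConsD: "\<forall>i. coeff (pCons a q) i \<in> L \<Longrightarrow> a \<in> L \<and> (\<forall>i. coeff q i \<in> L)"
  by (metis coeff_pCons_0 coeff_pCons_Suc)

lemma poly_in_subfield:
  assumes "is_subfield L" "c \<in> L" "\<forall>i. coeff q i \<in> L"
  shows "poly q c \<in> L"
  using assms(3)
proof (induction q)
  case (pCons a q)
  then show ?case
    using coeff_in_pConsD[OF pCons.prems] assms(1,2) by (simp add: is_subfield_def)
qed (use assms in \<open>simp add: is_subfield_def\<close>)

lemma coeff_synthetic_div_in_subfield:
  assumes "is_subfield L" "c \<in> L" "\<forall>i. coeff q i \<in> L"
  shows "\<forall>i. coeff (synthetic_div q c) i \<in> L"
  using assms(3)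
proof (induction q)
  case (pCons a q)
  then show ?case
    using coeff_in_pConsD[OF pCons.prems] poly_in_subfield[OF assms(1,2), of q]
    by (auto simp: coeff_pCons split: nat.split)
qed (use assms in \<open>simp add: is_subfield_def\<close>)

text \<open>Synthetic division by a root in \<open>L\<close> keeps the coefficients in
  \<open>L\<close>, so induction on the degree applies. The factorisation is an identity of
  functions on the whole field, where the estimates take place.\<close>

lemma alg_closed_subfield_splits:
  assumes L: "alg_closed_subfield L" and q: "\<forall>i. coeff q i \<in> L"
  shows "\<exists>c rs. \<forall>z. poly q z = c * (\<Prod>r\<leftarrow>rs. z - r)"
  using q
proof (induction "degree q" arbitrary: q)
  case 0
  then obtain c where "q = [:c:]"
    by (metis degree_eq_zeroE)
  then have "\<forall>z. poly q z = c * (\<Prod>r\<leftarrow>[]. z - r)"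
    by simp
  then show ?case
    by blast
next
  case (Suc n)
  have sub: "is_subfield L"
    using L by (simp add: alg_closed_subfield_def)
  obtain s where s: "s \<in> L" "poly q s = 0"
    using L Suc.prems Suc.hyps(2) unfolding alg_closed_subfield_def by (metis zero_less_Suc)
  have "n = degree (synthetic_div q s)"
    using Suc.hyps(2) by (simp add: degree_synthetic_div)
  then obtain c rs where crs: "\<And>z. poly (synthetic_div q s) z = c * (\<Prod>r\<leftarrow>rs. z - r)"
    using Suc.hyps(1) coeff_synthetic_div_in_subfield[OF sub s(1) Suc.prems] by blast
  have "poly q z = c * (\<Prod>r\<leftarrow>s # rs. z - r)" for z
  proof -
    have "poly q z = poly ([:- s, 1:] * synthetic_div q s + [:poly q s:]) z"
      by (simp only: synthetic_div_correct')
    also have "\<dots> = (z - s) * poly (synthetic_div q s) z"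
      using s(2) by (simp only: poly_add poly_mult) (simp add: algebra_simps)
    finally show ?thesis
      by (simp add: crs mult_ac)
  qed
  then show ?case
    by blast
qed

text \<open>With no root within \<delta> of \<open>a\<close>, each factor changes by a relative
  amount of at most \<open>vnorm (z - a) / \<delta>\<close>, and by the ultrametric inequality so
  does the product.\<close>

lemma vnorm_prod_list_diff_le:
  fixes a z :: "'a::nonarch_normed_field"
  assumes "0 < \<delta>" "vnorm (z - a) \<le> \<delta>" and "\<And>r. r \<in> set rs \<Longrightarrow> \<delta> < vnorm (a - r)"
  shows "vnorm ((\<Prod>r\<leftarrow>rs. z - r) - (\<Prod>r\<leftarrow>rs. a - r)) \<le> vnorm (\<Prod>r\<leftarrow>rs. a - r) * (vnorm (z - a) / \<delta>)"
  using assms(3)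
proof (induction rs)
  case (Cons r rs)
  let ?Z = "\<Prod>r\<leftarrow>rs. z - r" and ?A = "\<Prod>r\<leftarrow>rs. a - r"
  have r: "\<delta> < vnorm (a - r)"
    using Cons.prems by simp
  then have "vnorm ((a - r) - (z - r)) < vnorm (a - r)"
    using assms(2) by (simp add: vnorm_minus_commute)
  then have "vnorm (z - r) = vnorm (a - r)"
    by (rule vnorm_eq_of_diff_less)
  then have 1: "vnorm ((z - r) * (?Z - ?A)) \<le> vnorm (a - r) * (vnorm ?A * (vnorm (z - a) / \<delta>))"
    unfolding vnorm_mult using Cons.prems by (intro mult_mono Cons.IH) (auto simp: vnorm_nonneg)
  have "vnorm ((z - a) * ?A) = \<delta> * (vnorm ?A * (vnorm (z - a) / \<delta>))"
    using assms(1) by (simp add: vnorm_mult)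
  also have "\<dots> \<le> vnorm (a - r) * (vnorm ?A * (vnorm (z - a) / \<delta>))"
    using r assms(1) by (intro mult_right_mono) (auto simp: vnorm_nonneg)
  finally have 2: "vnorm ((z - a) * ?A) \<le> vnorm (a - r) * (vnorm ?A * (vnorm (z - a) / \<delta>))" .
  have "(\<Prod>r\<leftarrow>r # rs. z - r) - (\<Prod>r\<leftarrow>r # rs. a - r) = (z - r) * (?Z - ?A) + (z - a) * ?A"
    by (simp add: algebra_simps)
  then show ?case
    using 1 2 vnorm_ultrametric[of "(z - r) * (?Z - ?A)" "(z - a) * ?A"] by (simp add: vnorm_mult mult_ac)
qed (use assms in \<open>simp add: vnorm_zero vnorm_nonneg\<close>)

text \<open>Coefficients are approximated one at a time; the tolerance for the tail is divided by
  \<open>m\<close>, since the tail is multiplied by an \<open>x\<close> of norm at most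
  \<open>m\<close>.\<close>

lemma poly_approx_in_dense_subfield:
  fixes q :: "'a::nonarch_normed_field poly" and L :: "'a set"
  assumes "is_subfield L" "closure L = UNIV" "1 \<le> m" "0 < e"
  shows "\<exists>q'. (\<forall>i. coeff q' i \<in> L) \<and> (\<forall>x. vnorm x \<le> m \<longrightarrow> vnorm (poly q x - poly q' x) \<le> e)"
  using assms(4)
proof (induction q arbitrary: e)
  case 0
  then show ?case
    using assms by (intro exI[of _ 0]) (auto simp: is_subfield_def vnorm_zero)
next
  case (pCons a q)
  obtain a' where a': "a' \<in> L" "dist a' a < e"
    using closure_approachableD[of a L e] assms(2) pCons.prems by (auto simp: dist_commute)
  obtain q' where q': "\<forall>i. coeff q' i \<in> L"
      "\<And>x. vnorm x \<le> m \<Longrightarrow> vnorm (poly q x - poly q' x) \<le> e / m"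
    using pCons.IH[of "e / m"] pCons.prems assms(3) by auto
  have "vnorm (poly (pCons a q) x - poly (pCons a' q') x) \<le> e" if x: "vnorm x \<le> m" for x
  proof -
    have "vnorm x * vnorm (poly q x - poly q' x) \<le> m * (e / m)"
      using assms(3) x q'(2)[OF x] by (intro mult_mono) (auto simp: vnorm_nonneg)
    moreover have "poly (pCons a q) x - poly (pCons a' q') x = (a - a') + x * (poly q x - poly q' x)"
      by (simp add: algebra_simps)
    moreover have "vnorm (a - a') < e"
      using a'(2) by (simp add: dist_vnorm vnorm_minus_commute)
    ultimately show ?thesis
      using vnorm_ultrametric[of "a - a'" "x * (poly q x - poly q' x)"] assms(3)
      by (simp only: vnorm_mult) simp
  qed
  then show ?case
    using a'(1) q'(1) by (intro exI[of _ "pCons a' q'"]) (auto simp: coeff_pCons split: nat.split)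
qed

text \<open>
  Approximating \<open>q\<close> by a polynomial that splits over \<open>L\<close> spares us the proof that the completion of
  an algebraically closed field is algebraically closed.
\<close>

lemma vnorm_poly_diff_le_of_bounded_below:
  fixes q :: "'a::nonarch_normed_field poly" and L :: "'a set"
  assumes L: "alg_closed_subfield L" "closure L = UNIV" and "0 < \<delta>" "0 < \<eta>"
    and below: "\<And>x. vnorm (x - a) \<le> \<delta> \<Longrightarrow> \<eta> \<le> vnorm (poly q x)"
    and z: "vnorm (z - a) \<le> \<delta>"
  shows "vnorm (poly q z - poly q a) \<le> vnorm (poly q a) * (vnorm (z - a) / \<delta>)"
proof (cases "z = a")
  case False
  \<comment> \<open>An approximation error of at most \<open>K\<close>, the bound to be shown, is
    absorbed by the ultrametric inequality; one of at most \<open>\<eta> / 2\<close> leaves the norm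
    of \<open>q\<close> on the disc unchanged. Excluding \<open>z = a\<close> makes \<open>K\<close>
    positive.\<close>
  define K where "K = vnorm (poly q a) * (vnorm (z - a) / \<delta>)"
  have qa: "\<eta> \<le> vnorm (poly q a)"
    using below[of a] \<open>0 < \<delta>\<close> by (simp add: vnorm_zero)
  then have "0 < K"
    using False \<open>0 < \<delta>\<close> \<open>0 < \<eta>\<close> vnorm_nonneg[of "z - a"] vnorm_eq_0[of "z - a"] unfolding K_def
    by (intro mult_pos_pos divide_pos_pos) (simp_all add: order_less_le)
  define m where "m = Max {1, vnorm a, \<delta>}"
  have le_m: "vnorm x \<le> m" if "vnorm (x - a) \<le> \<delta>" for x
    using that vnorm_ultrametric[of "x - a" a] by (auto simp: m_def max_def split: if_splits)
  obtain q' where q': "\<forall>i. coeff q' i \<in> L"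
    and close: "\<And>x. vnorm x \<le> m \<Longrightarrow> vnorm (poly q x - poly q' x) \<le> min K (\<eta> / 2)"
    using poly_approx_in_dense_subfield[of L m "min K (\<eta> / 2)" q] L \<open>0 < K\<close> \<open>0 < \<eta>\<close>
    unfolding alg_closed_subfield_def m_def by auto
  have eq: "vnorm (poly q' x) = vnorm (poly q x)" if "vnorm (x - a) \<le> \<delta>" for x
    using below[OF that] close[OF le_m[OF that]] \<open>0 < \<eta>\<close> by (intro vnorm_eq_of_diff_less) auto
  obtain c rs where split: "\<And>z. poly q' z = c * (\<Prod>r\<leftarrow>rs. z - r)"
    using alg_closed_subfield_splits[OF L(1) q'] by blast
  \<comment> \<open>A root of \<open>q'\<close> in the disc would also be a zero of
    \<open>q\<close>, since both have the same norm there.\<close>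
  have "\<delta> < vnorm (a - r)" if "r \<in> set rs" for r
  proof (rule ccontr)
    assume "\<not> \<delta> < vnorm (a - r)"
    then have r: "vnorm (r - a) \<le> \<delta>"
      by (simp add: vnorm_minus_commute)
    have "(\<Prod>r'\<leftarrow>rs. r - r') = 0"
      using that by (force simp: prod_list_zero_iff)
    then have "poly q' r = 0"
      by (simp add: split)
    then show False
      using eq[OF r] below[OF r] \<open>0 < \<eta>\<close> by (simp add: vnorm_zero)
  qed
  then have "vnorm ((\<Prod>r\<leftarrow>rs. z - r) - (\<Prod>r\<leftarrow>rs. a - r)) \<le> vnorm (\<Prod>r\<leftarrow>rs. a - r) * (vnorm (z - a) / \<delta>)"
    by (intro vnorm_prod_list_diff_le \<open>0 < \<delta>\<close> z)
  then have "vnorm c * vnorm ((\<Prod>r\<leftarrow>rs. z - r) - (\<Prod>r\<leftarrow>rs. a - r))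
      \<le> vnorm c * (vnorm (\<Prod>r\<leftarrow>rs. a - r) * (vnorm (z - a) / \<delta>))"
    by (intro mult_left_mono vnorm_nonneg)
  then have "vnorm (poly q' z - poly q' a) \<le> vnorm (poly q' a) * (vnorm (z - a) / \<delta>)"
    unfolding split by (simp add: vnorm_mult mult_ac flip: right_diff_distrib)
  also have "vnorm (poly q' a) = vnorm (poly q a)"
    using \<open>0 < \<delta>\<close> by (intro eq) (simp add: vnorm_zero)
  finally have 1: "vnorm (poly q' z - poly q' a) \<le> K"
    by (simp add: K_def)
  have 2: "vnorm (poly q z - poly q' z) \<le> K" "vnorm (poly q a - poly q' a) \<le> K"
    using close[of z] close[of a] le_m[OF z] le_m[of a] \<open>0 < \<delta>\<close> by (auto simp: vnorm_zero)
  have "poly q z - poly q a = (poly q z - poly q' z) + (poly q' z - poly q' a) - (poly q a - poly q' a)"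
    by simp
  then have "vnorm (poly q z - poly q a) \<le> K"
    using 1 2 vnorm_ultrametric[of "poly q z - poly q' z" "poly q' z - poly q' a"]
      vnorm_diff_ultrametric[of "(poly q z - poly q' z) + (poly q' z - poly q' a)" "poly q a - poly q' a"]
    by simp
  then show ?thesis
    by (simp add: K_def)
qed (simp add: vnorm_zero)


section \<open>Fatou sets of polynomials\<close>

lemma dist_Aff_le: "dist (Aff z) (Aff w) \<le> dist z w"
proof -
  have "1 * 1 \<le> max (vnorm z) 1 * max (vnorm w) 1"
    by (intro mult_mono) auto
  then show ?thesis
    using vnorm_nonneg[of "z - w"]
    by (simp add: dist_proj_line_def dist_vnorm divide_le_eq mult_le_cancel_left1)
qed

text \<open>If the norm of \<open>w\<close> exceeded \<open>max (vnorm z) 1\<close>, the chordal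
  distance would equal the excluded value. Hence \<open>w\<close> obeys the same bound as
  \<open>z\<close>, and the chordal denominator is at most its square.\<close>

lemma near_AffE:
  fixes z :: "'a::nonarch_normed_field"
  assumes "dist (Aff z) y < 1 / max (vnorm z) 1"
  obtains w where "y = Aff w" "dist z w \<le> (max (vnorm z) 1)\<^sup>2 * dist (Aff z) y"
proof (cases y)
  case Infty
  then show ?thesis
    using assms by (simp add: dist_proj_line_def)
next
  case (Aff w)
  let ?m = "max (vnorm z) 1"
  have m: "?m > 0"
    by simp
  have w: "vnorm w \<le> ?m"
  proof (rule ccontr)
    assume big: "\<not> vnorm w \<le> ?m"
    then have "vnorm (z - w) = vnorm w"
      using vnorm_eq_of_diff_less[of w "w - z"] by (simp add: vnorm_minus_commute)
    then have "dist (Aff z) y = 1 / ?m"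
      using big by (simp add: Aff dist_proj_line_def)
    then show False
      using assms by simp
  qed
  have "dist z w = dist (Aff z) y * (?m * max (vnorm w) 1)"
    by (simp add: Aff dist_proj_line_def dist_vnorm)
  also have "\<dots> \<le> dist (Aff z) y * (?m * ?m)"
    using w by (intro mult_left_mono) auto
  finally show ?thesis
    using that Aff by (simp add: power2_eq_square mult_ac)
qed

lemma near_Aff_dist:
  fixes z :: "'a::nonarch_normed_field"
  assumes "0 < \<delta>"
  obtains \<delta>' where "0 < \<delta>'" "\<And>y. dist (Aff z) y < \<delta>' \<Longrightarrow> \<exists>w. y = Aff w \<and> dist z w < \<delta>"
proof
  let ?m = "max (vnorm z) 1"
  let ?\<delta> = "min (1 / ?m) (\<delta> / ?m\<^sup>2)"
  have m: "?m > 0"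
    by simp
  show "0 < ?\<delta>"
    using assms m by simp
  show "\<exists>w. y = Aff w \<and> dist z w < \<delta>" if y: "dist (Aff z) y < ?\<delta>" for y
  proof -
    obtain w where w: "y = Aff w" "dist z w \<le> ?m\<^sup>2 * dist (Aff z) y"
      using near_AffE[of z y] y by auto
    have "?m\<^sup>2 * dist (Aff z) y < \<delta>"
      using y m by (simp add: pos_less_divide_eq mult.commute)
    with w show ?thesis
      by auto
  qed
qed

lemma near_Infty:
  assumes "dist Infty y < 1 / max R 1"
  shows "y = Infty \<or> (\<exists>w. y = Aff w \<and> R < vnorm w)"
proof (cases y)
  case (Aff w)
  have "R < vnorm w"
  proof (rule ccontr)
    assume "\<not> R < vnorm w"
    then have "1 / max R 1 \<le> 1 / max (vnorm w) 1"
      by (intro divide_left_mono mult_pos_pos) auto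
    then show False
      using assms by (simp add: Aff dist_proj_line_def)
  qed
  then show ?thesis
    using Aff by blast
qed simp

lemma open_proj_lineI:
  fixes U :: "'a::nonarch_normed_field proj_line set"
  assumes "\<And>a. Aff a \<in> U \<Longrightarrow> \<exists>\<delta>>0. \<forall>w. dist a w < \<delta> \<longrightarrow> Aff w \<in> U"
    and "Infty \<in> U \<Longrightarrow> \<exists>R. \<forall>w. R < vnorm w \<longrightarrow> Aff w \<in> U"
  shows "open U"
  unfolding open_dist
proof
  fix x
  assume "x \<in> U"
  show "\<exists>e>0. \<forall>y. dist y x < e \<longrightarrow> y \<in> U"
  proof (cases x)
    case (Aff a)
    then obtain \<delta> where \<delta>: "\<delta> > 0" "\<And>w. dist a w < \<delta> \<Longrightarrow> Aff w \<in> U"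
      using assms(1) \<open>x \<in> U\<close> by blast
    obtain \<delta>' where "\<delta>' > 0" "\<And>y. dist (Aff a) y < \<delta>' \<Longrightarrow> \<exists>w. y = Aff w \<and> dist a w < \<delta>"
      using near_Aff_dist[OF \<delta>(1), of a] by blast
    then show ?thesis
      using \<delta>(2) Aff by (intro exI[of _ \<delta>']) (auto simp: dist_commute)
  next
    case Infty
    then obtain R where R: "\<And>w. R < vnorm w \<Longrightarrow> Aff w \<in> U"
      using assms(2) \<open>x \<in> U\<close> by blast
    have "y \<in> U" if "dist y x < 1 / max R 1" for y
      using near_Infty[of y R] that R \<open>x \<in> U\<close> Infty by (auto simp: dist_commute)
    then show ?thesis
      by (intro exI[of _ "1 / max R 1"]) simp
  qed
qed

lemma equicontinuous_on_proj_lineI: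
  fixes U :: "'a::nonarch_normed_field proj_line set"
  assumes "\<And>a e. Aff a \<in> U \<Longrightarrow> e > 0 \<Longrightarrow>
      \<exists>\<delta>>0. \<forall>F\<in>\<F>. \<forall>w. dist a w < \<delta> \<longrightarrow> Aff w \<in> U \<longrightarrow> dist (F (Aff a)) (F (Aff w)) < e"
    and "\<And>e. Infty \<in> U \<Longrightarrow> e > 0 \<Longrightarrow>
      \<exists>R. \<forall>F\<in>\<F>. \<forall>w. R < vnorm w \<longrightarrow> Aff w \<in> U \<longrightarrow> dist (F Infty) (F (Aff w)) < e"
  shows "equicontinuous_on U \<F>"
  unfolding equicontinuous_on_def
proof (intro ballI allI impI)
  fix x and e :: real
  assume "x \<in> U" "e > 0"
  show "\<exists>\<delta>>0. \<forall>F\<in>\<F>. \<forall>y\<in>U. dist x y < \<delta> \<longrightarrow> dist (F x) (F y) < e"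
  proof (cases x)
    case (Aff a)
    then obtain \<delta> where \<delta>: "\<delta> > 0"
      "\<And>F w. F \<in> \<F> \<Longrightarrow> dist a w < \<delta> \<Longrightarrow> Aff w \<in> U \<Longrightarrow> dist (F (Aff a)) (F (Aff w)) < e"
      using assms(1) \<open>x \<in> U\<close> \<open>e > 0\<close> by meson
    obtain \<delta>' where "\<delta>' > 0" "\<And>y. dist (Aff a) y < \<delta>' \<Longrightarrow> \<exists>w. y = Aff w \<and> dist a w < \<delta>"
      using near_Aff_dist[OF \<delta>(1), of a] by blast
    then show ?thesis
      using \<delta>(2) Aff by (intro exI[of _ \<delta>']) blast
  next
    case Infty
    then obtain R where R:
      "\<And>F w. F \<in> \<F> \<Longrightarrow> R < vnorm w \<Longrightarrow> Aff w \<in> U \<Longrightarrow> dist (F Infty) (F (Aff w)) < e"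
      using assms(2) \<open>x \<in> U\<close> \<open>e > 0\<close> by meson
    have "dist (F x) (F y) < e" if "F \<in> \<F>" "y \<in> U" "dist x y < 1 / max R 1" for F y
      using near_Infty[of y R] that R Infty \<open>e > 0\<close> by auto
    then show ?thesis
      by (intro exI[of _ "1 / max R 1"]) simp
  qed
qed

section \<open>Iterates and the Fatou set\<close>

lemma funpow_poly_map_Aff: "(poly_map f ^^ n) (Aff z) = Aff ((poly f ^^ n) z)"
  by (induction n) simp_all

lemma funpow_poly_map_Infty: "(poly_map f ^^ n) Infty = Infty"
  by (induction n) simp_all

text \<open>Iterates being polynomials again, the estimate for polynomials without zeros in a disc
  applies to all of them with the same constants.\<close>

lemma funpow_poly: "\<exists>q. poly q = poly (f :: 'a::comm_semiring_1 poly) ^^ n"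
proof (induction n)
  case 0
  show ?case
    by (rule exI[of _ "[:0, 1:]"]) auto
next
  case (Suc n)
  then obtain q where "poly q = poly f ^^ n"
    by blast
  then show ?case
    by (intro exI[of _ "pcompose f q"]) (auto simp: poly_pcompose)
qed

text \<open>Equicontinuity on \<open>V\<close> carries over to the preimage of \<open>V\<close>: a
  positive iterate is an iterate after \<open>f\<close>, and \<open>f\<close> is continuous.\<close>

lemma Fatou_backward:
  fixes f :: "'a::nonarch_normed_field poly"
  assumes "Aff (poly f z) \<in> Fatou (poly_map f)"
  shows "Aff z \<in> Fatou (poly_map f)"
proof -
  let ?F = "poly_map f"
  obtain V where V: "open V" "equicontinuous_on V (range (\<lambda>n. ?F ^^ n))" "Aff (poly f z) \<in> V"
    using assms unfolding Fatou_def by blast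
  \<comment> \<open>Taking affine points alone makes the conditions at \<open>Infty\<close>
    vacuous.\<close>
  define U where "U = {Aff w |w. Aff (poly f w) \<in> V}"
  have Aff_U: "Aff w \<in> U \<longleftrightarrow> Aff (poly f w) \<in> V" for w
    by (simp add: U_def)
  have near: "\<exists>\<delta>>0. \<forall>w. dist a w < \<delta> \<longrightarrow> dist (Aff (poly f a)) (Aff (poly f w)) < e"
    if "e > 0" for a :: 'a and e
  proof -
    obtain \<delta> where "\<delta> > 0" "\<And>w. dist w a < \<delta> \<Longrightarrow> dist (poly f w) (poly f a) < e"
      using continuous_on_poly_nonarch[of UNIV f] \<open>e > 0\<close> unfolding continuous_on_iff by blast
    then show ?thesis
      by (metis dist_Aff_le dist_commute order_le_less_trans)
  qed
  have "open U"
  proof (rule open_proj_lineI)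
    fix a
    assume "Aff a \<in> U"
    then obtain e where "e > 0" "\<And>y. dist y (Aff (poly f a)) < e \<Longrightarrow> y \<in> V"
      using V(1) unfolding open_dist Aff_U by blast
    then show "\<exists>\<delta>>0. \<forall>w. dist a w < \<delta> \<longrightarrow> Aff w \<in> U"
      using near[of e a] unfolding Aff_U by (metis dist_commute)
  qed (simp add: U_def)
  moreover have "equicontinuous_on U (range (\<lambda>n. ?F ^^ n))"
  proof (rule equicontinuous_on_proj_lineI)
    fix a and e :: real
    assume a: "Aff a \<in> U" and "e > 0"
    obtain e' where e': "e' > 0"
      "\<And>n y. y \<in> V \<Longrightarrow> dist (Aff (poly f a)) y < e' \<Longrightarrow>
        dist ((?F ^^ n) (Aff (poly f a))) ((?F ^^ n) y) < e"
      using V(2) a \<open>e > 0\<close> unfolding equicontinuous_on_def Aff_U by (metis rangeI)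
    obtain \<delta> where \<delta>: "\<delta> > 0" "\<And>w. dist a w < \<delta> \<Longrightarrow> dist (Aff (poly f a)) (Aff (poly f w)) < e'"
      using near[OF e'(1), of a] by blast
    \<comment> \<open>The bound by \<open>e\<close> takes care of \<open>n = 0\<close>, the iterate
      that does not factor through \<open>f\<close>.\<close>
    have "dist ((?F ^^ n) (Aff a)) ((?F ^^ n) (Aff w)) < e"
      if "dist a w < min \<delta> e" "Aff w \<in> U" for n w
    proof (cases n)
      case 0
      then show ?thesis
        using dist_Aff_le[of a w] that(1) by simp
    next
      case (Suc m)
      have "dist ((?F ^^ m) (Aff (poly f a))) ((?F ^^ m) (Aff (poly f w))) < e"
        using that \<delta>(2) by (intro e'(2)) (auto simp: Aff_U)
      then show ?thesis
        by (simp add: Suc funpow_swap1)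
    qed
    then show "\<exists>\<delta>>0. \<forall>F\<in>range (\<lambda>n. ?F ^^ n). \<forall>w. dist a w < \<delta> \<longrightarrow> Aff w \<in> U \<longrightarrow>
        dist (F (Aff a)) (F (Aff w)) < e"
      using \<delta>(1) \<open>e > 0\<close> by (intro exI[of _ "min \<delta> e"]) auto
  qed (simp add: U_def)
  ultimately have "U \<subseteq> Fatou ?F"
    by (rule Fatou_largest(3))
  then show ?thesis
    using V(3) Aff_U by blast
qed

text \<open>
  Montel's theorem for the complement of \<open>B\<close>: no iterate maps a disc in the complement to a point
  of a fixed disc around \<open>b \<in> B\<close>.
\<close>

lemma complement_subset_Fatou:
  fixes f :: "'a::nonarch_normed_field poly" and L :: "'a set"
  assumes L: "alg_closed_subfield L" "closure L = UNIV"
    and B: "B \<noteq> {}" "poly f -` B \<subseteq> B" "B \<subseteq> cball 0 M"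
    and \<delta>: "\<delta> > 0" "\<And>z. z \<in> B \<Longrightarrow> cball z \<delta> \<subseteq> B"
    and escape: "\<And>z. R < vnorm z \<Longrightarrow> vnorm z \<le> vnorm (poly f z)"
  shows "- Aff ` B \<subseteq> Fatou (poly_map f)"
proof (rule Fatou_largest(3))
  let ?F = "poly_map f"
  let ?U = "- Aff ` B"
  have Aff_U: "Aff w \<in> ?U \<longleftrightarrow> w \<notin> B" for w
    by auto
  have cball_disjoint: "w \<notin> B" if "a \<notin> B" "dist a w \<le> \<delta>" for a w
    using that \<delta>(2)[of w] by (auto simp: subset_iff dist_commute)
  have B_bounded: "vnorm z \<le> M" if "z \<in> B" for z
    using B(3) that by (auto simp: dist_vnorm vnorm_minus)
  show "open ?U"
  proof (rule open_proj_lineI)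
    show "\<exists>\<delta>>0. \<forall>w. dist a w < \<delta> \<longrightarrow> Aff w \<in> ?U" if "Aff a \<in> ?U" for a
      using cball_disjoint[of a] that \<delta>(1) unfolding Aff_U by (intro exI[of _ \<delta>]) auto
    show "\<exists>R. \<forall>w. R < vnorm w \<longrightarrow> Aff w \<in> ?U"
      using B_bounded unfolding Aff_U by (meson not_le)
  qed
  show "equicontinuous_on ?U (range (\<lambda>n. ?F ^^ n))"
  proof (rule equicontinuous_on_proj_lineI)
    fix a and e :: real
    assume "Aff a \<in> ?U" and "e > 0"
    then have a: "a \<notin> B"
      by blast
    obtain b where b: "b \<in> B"
      using B(1) by blast
    let ?mb = "max (vnorm b) 1"
    have mb: "?mb > 0"
      by simp
    \<comment> \<open>The norm of \<open>poly q a - b\<close> is at most \<open>?ma * ?mb\<close>.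
      The chordal denominator cancels \<open>?ma\<close>, however large the iterate is, and the
      radius compensates \<open>?mb\<close>; so the radius is independent of
      \<open>n\<close>.\<close>
    have "dist (Aff ((poly f ^^ n) a)) (Aff ((poly f ^^ n) w)) < e"
      if w: "dist a w < min \<delta> (e * \<delta> / ?mb)" for w n
    proof -
      obtain q where q: "poly q = poly f ^^ n"
        using funpow_poly by blast
      have stay: "(poly f ^^ n) x \<notin> B" if "x \<notin> B" for x
        using that B(2) by (induction n) auto
      have below: "\<delta> \<le> vnorm (poly (q - [:b:]) x)" if x: "vnorm (x - a) \<le> \<delta>" for x
      proof (rule ccontr)
        assume "\<not> \<delta> \<le> vnorm (poly (q - [:b:]) x)"
        then have "poly q x \<in> cball b \<delta>"
          by (simp add: dist_vnorm vnorm_minus_commute)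
        moreover have "poly q x \<notin> B"
          unfolding q using stay cball_disjoint[OF a] x by (simp add: dist_vnorm vnorm_minus_commute)
        ultimately show False
          using \<delta>(2)[OF b] by blast
      qed
      have "vnorm (poly (q - [:b:]) w - poly (q - [:b:]) a)
          \<le> vnorm (poly (q - [:b:]) a) * (vnorm (w - a) / \<delta>)"
        using w by (intro vnorm_poly_diff_le_of_bounded_below[OF L \<delta>(1) \<delta>(1) below])
          (simp_all add: dist_vnorm vnorm_minus_commute)
      then have 1: "vnorm (poly q a - poly q w) \<le> vnorm (poly q a - b) * (dist a w / \<delta>)"
        by (simp add: dist_vnorm vnorm_minus_commute)
      let ?ma = "max (vnorm (poly q a)) 1" and ?mw = "max (vnorm (poly q w)) 1"
      have "vnorm (poly q a - b) \<le> ?ma * ?mb"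
      proof -
        have "?ma * 1 \<le> ?ma * ?mb" "1 * ?mb \<le> ?ma * ?mb"
          by (intro mult_mono; simp)+
        then have "max (vnorm (poly q a)) (vnorm b) \<le> ?ma * ?mb"
          by (simp only: mult_1_left mult_1_right max.bounded_iff)
        with vnorm_diff_ultrametric show ?thesis
          by (rule order_trans)
      qed
      then have "vnorm (poly q a - b) * (dist a w / \<delta>) \<le> ?ma * ?mb * (dist a w / \<delta>)"
        using \<delta>(1) by (intro mult_right_mono) auto
      also have "\<dots> < ?ma * e"
      proof -
        have "?mb * (dist a w / \<delta>) < e"
          using w \<delta>(1) mb by (simp add: field_simps)
        then show ?thesis
          by (simp only: mult.assoc) (rule mult_strict_left_mono, auto)
      qed
      also have "\<dots> \<le> ?ma * ?mw * e"
        using \<open>e > 0\<close> by (intro mult_right_mono) (auto simp: mult_le_cancel_left1)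
      finally have "vnorm (poly q a - poly q w) < e * (?ma * ?mw)"
        using 1 by (simp add: mult_ac)
      moreover have "0 < ?ma * ?mw"
        by (intro mult_pos_pos) auto
      ultimately show ?thesis
        unfolding q[symmetric] by (simp add: dist_proj_line_def pos_divide_less_eq)
    qed
    then show "\<exists>\<delta>>0. \<forall>F\<in>range (\<lambda>n. ?F ^^ n). \<forall>w. dist a w < \<delta> \<longrightarrow> Aff w \<in> ?U \<longrightarrow>
        dist (F (Aff a)) (F (Aff w)) < e"
      using \<delta>(1) \<open>e > 0\<close> mb
      by (intro exI[of _ "min \<delta> (e * \<delta> / ?mb)"]) (auto simp: funpow_poly_map_Aff)
  next
    fix e :: real
    assume "e > 0"
    \<comment> \<open>Beyond \<open>R\<close> the iterates do not decrease the norm, and beyond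
      \<open>1 / e\<close> the chordal distance to \<open>Infty\<close> is below
      \<open>e\<close>.\<close>
    have "dist Infty (Aff ((poly f ^^ n) w)) < e" if w: "max R (1 / e) < vnorm w" for w n
    proof -
      have "vnorm w \<le> vnorm ((poly f ^^ n) w)"
      proof (induction n)
        case (Suc n)
        then show ?case
          using escape[of "(poly f ^^ n) w"] w by simp
      qed simp
      then have "1 / e < max (vnorm ((poly f ^^ n) w)) 1"
        using w by linarith
      then show ?thesis
        using \<open>e > 0\<close> by (simp add: dist_proj_line_def divide_less_eq mult.commute)
    qed
    then show "\<exists>R. \<forall>F\<in>range (\<lambda>n. ?F ^^ n). \<forall>w. R < vnorm w \<longrightarrow> Aff w \<in> ?U \<longrightarrow>
        dist (F Infty) (F (Aff w)) < e"
      by (intro exI[of _ "max R (1 / e)"]) (auto simp: funpow_poly_map_Aff funpow_poly_map_Infty)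
  qed
qed

text \<open>An orbit leaving \<open>B\<close> enters the Fatou set, so it starts there by backward
  invariance. Conversely, equicontinuity at a trapped point would yield a second point whose orbit
  stays within \<rho> of the first, contradicting the uniqueness of shadows.\<close>

lemma Julia_eq_trapped:
  fixes f :: "'a::nonarch_normed_field poly" and L :: "'a set"
  assumes L: "alg_closed_subfield L" "closure L = UNIV"
    and B: "B \<noteq> {}" "poly f -` B \<subseteq> B" "B \<subseteq> cball 0 M"
    and \<delta>: "\<delta> > 0" "\<And>z. z \<in> B \<Longrightarrow> cball z \<delta> \<subseteq> B"
    and escape: "\<And>z. R < vnorm z \<Longrightarrow> vnorm z \<le> vnorm (poly f z)"
    and expanding: "expanding_map B \<rho> s \<mu> (poly f)"
    and nontrivial: "\<And>e. e > 0 \<Longrightarrow> \<exists>x::'a. x \<noteq> 0 \<and> vnorm x < e"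
  shows "Julia (poly_map f) = Aff ` trapped B (poly f)"
proof (intro equalityI subsetI)
  have Fatou: "- Aff ` B \<subseteq> Fatou (poly_map f)"
    by (rule complement_subset_Fatou[OF L B \<delta> escape])
  have Fatou_funpow: "Aff z \<in> Fatou (poly_map f)" if "Aff ((poly f ^^ n) z) \<in> Fatou (poly_map f)" for n z
    using that by (induction n) (auto intro: Fatou_backward)
  fix x
  assume x: "x \<in> Julia (poly_map f)"
  then have "x \<in> Aff ` B"
    using Fatou unfolding Julia_def by blast
  then obtain z where z: "x = Aff z"
    by blast
  have "(poly f ^^ n) z \<in> B" for n
    using Fatou_funpow[of n z] Fatou x unfolding z Julia_def by blast
  then show "x \<in> Aff ` trapped B (poly f)"
    unfolding z trapped_def by blast
next
  interpret expanding_map B \<rho> s \<mu> "poly f"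
    by fact
  fix x
  assume "x \<in> Aff ` trapped B (poly f)"
  then obtain z where x: "x = Aff z" and z: "\<And>n. (poly f ^^ n) z \<in> B"
    by (auto simp: trapped_def)
  have "Aff z \<notin> Fatou (poly_map f)"
  proof
    assume zF: "Aff z \<in> Fatou (poly_map f)"
    define m where "m = max M 1"
    have m: "m > 0"
      by (simp add: m_def)
    have le_m: "max (vnorm ((poly f ^^ n) z)) 1 \<le> m" for n
      using B(3) z[of n] by (auto simp: m_def dist_vnorm vnorm_minus)
    \<comment> \<open>The orbit has norms at most \<open>m\<close>: a chordal distance below
      \<open>1 / m\<close> makes \<open>near_AffE\<close> applicable, and
      \<open>\<rho> / m\<^sup>2\<close> makes up for its factor.\<close>
    define e where "e = min (1 / m) (\<rho> / m\<^sup>2)"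
    have "e > 0"
      using m \<rho>_pos by (simp add: e_def)
    then obtain \<delta>' where \<delta>': "\<delta>' > 0"
      "\<And>n y. y \<in> Fatou (poly_map f) \<Longrightarrow> dist (Aff z) y < \<delta>' \<Longrightarrow>
        dist ((poly_map f ^^ n) (Aff z)) ((poly_map f ^^ n) y) < e"
      using Fatou_largest(2)[of "poly_map f"] zF unfolding equicontinuous_on_def by (metis rangeI)
    obtain \<delta>'' where \<delta>'': "\<delta>'' > 0" "\<And>y. dist y (Aff z) < \<delta>'' \<Longrightarrow> y \<in> Fatou (poly_map f)"
      using Fatou_largest(1)[of "poly_map f"] zF unfolding open_dist by blast
    obtain u :: 'a where u: "u \<noteq> 0" "vnorm u < min \<delta>' \<delta>''"
      using nontrivial[of "min \<delta>' \<delta>''"] \<delta>'(1) \<delta>''(1) by (metis min_less_iff_conj)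
    let ?y = "z + u"
    have "dist z ?y < min \<delta>' \<delta>''"
      using u(2) by (simp add: dist_vnorm vnorm_minus)
    then have y: "dist (Aff z) (Aff ?y) < min \<delta>' \<delta>''"
      using dist_Aff_le[of z ?y] by simp
    have "dist ((poly f ^^ n) z) ((poly f ^^ n) ?y) \<le> \<rho>" for n
    proof -
      let ?a = "(poly f ^^ n) z" and ?b = "(poly f ^^ n) ?y"
      let ?ma = "max (vnorm ?a) 1"
      have lt: "dist (Aff ?a) (Aff ?b) < e"
        using \<delta>'(2)[of "Aff ?y" n] \<delta>''(2)[of "Aff ?y"] y by (simp add: funpow_poly_map_Aff dist_commute)
      have "1 / m \<le> 1 / ?ma"
        using le_m[of n] by (intro divide_left_mono) auto
      then have "dist (Aff ?a) (Aff ?b) < 1 / ?ma"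
        using lt by (simp add: e_def)
      then have "dist ?a ?b \<le> ?ma\<^sup>2 * dist (Aff ?a) (Aff ?b)"
        by (rule near_AffE) simp
      also have "\<dots> \<le> m\<^sup>2 * (\<rho> / m\<^sup>2)"
        using le_m[of n] lt by (intro mult_mono power_mono) (auto simp: e_def)
      finally show ?thesis
        using m by simp
    qed
    then have "z = ?y"
      using shadows_unique[of "\<lambda>n. (poly f ^^ n) z" z ?y] z \<rho>_pos by simp
    then show False
      using u(1) by simp
  qed
  then show "x \<in> Julia (poly_map f)"
    by (simp add: x Julia_def)
qed


section \<open>Perturbations of an immediately expanding polynomial\<close>

text \<open>As \<open>C * \<rho> < 1 < \<mu>\<close>, the second order error on a ball of radius
  \<rho> is smaller than the linear term, whence exact scaling. Agreement of \<open>s\<close> with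
  the norm of the derivative on \<open>B\<close> is enough, which admits the \<open>s\<close> of
  another polynomial.\<close>

lemma expanding_map_poly:
  fixes q :: "'a::nonarch_normed_field poly"
  assumes complete: "complete (UNIV :: 'a set)"
    and m: "1 \<le> m" and q: "gauss_le m q C" and B: "\<And>z. z \<in> B \<Longrightarrow> vnorm z \<le> m"
    and \<rho>: "0 < \<rho>" "C * \<rho> < 1" "\<And>z. z \<in> B \<Longrightarrow> cball z \<rho> \<subseteq> B"
    and \<mu>: "1 < \<mu>" "\<And>z. z \<in> B \<Longrightarrow> \<mu> \<le> s z"
    and s: "\<And>z. z \<in> B \<Longrightarrow> s z = vnorm (poly (pderiv q) z)"
  shows "expanding_map B \<rho> s \<mu> (poly q)"
proof
  have "0 \<le> C * \<rho>"
    using gauss_le_nonneg[OF q] \<rho>(1) by simp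
  have approx: "vnorm (poly q x - poly q y - poly (pderiv q) z * (x - y)) \<le> C * \<rho> * vnorm (x - y)"
    if "z \<in> B" "x \<in> cball z \<rho>" "y \<in> cball z \<rho>" for x y z
  proof -
    have "x \<in> B" "y \<in> B"
      using \<rho>(3) that by blast+
    then show ?thesis
      using that by (intro vnorm_poly_linear_approx_le[OF m q] B)
        (auto simp: dist_vnorm vnorm_minus_commute)
  qed
  show dist_eq: "dist (poly q x) (poly q y) = s z * dist x y"
    if "z \<in> B" "x \<in> cball z \<rho>" "y \<in> cball z \<rho>" for x y z
  proof (cases "x = y")
    case False
    let ?l = "poly (pderiv q) z * (x - y)"
    have "0 < vnorm (x - y)"
      using False vnorm_nonneg[of "x - y"] vnorm_eq_0[of "x - y"] by (simp add: order_less_le)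
    then have "C * \<rho> * vnorm (x - y) < s z * vnorm (x - y)"
      using \<rho>(2) \<mu>(1) \<mu>(2)[OF that(1)] by (intro mult_strict_right_mono) auto
    then have "vnorm (?l - (poly q x - poly q y)) < vnorm ?l"
      using approx[OF that] s[OF that(1)] by (simp add: vnorm_mult vnorm_minus_commute)
    then have "vnorm (poly q x - poly q y) = vnorm ?l"
      by (rule vnorm_eq_of_diff_less)
    then show ?thesis
      by (simp add: dist_vnorm vnorm_mult s[OF that(1)])
  qed simp
  show "cball (poly q z) \<rho> \<subseteq> poly q ` cball z \<rho>" if z: "z \<in> B" for z
  proof
    fix w
    assume w: "w \<in> cball (poly q z) \<rho>"
    let ?D = "poly (pderiv q) z"
    \<comment> \<open>Newton's iteration for \<open>poly q x = w\<close> with the derivative frozen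
      at \<open>z\<close>, a contraction because of \<open>C * \<rho> < 1\<close>.\<close>
    define N where "N x = x - (poly q x - w) / ?D" for x
    have D: "1 < vnorm ?D"
      using \<mu>(1) \<mu>(2)[OF z] s[OF z] by simp
    then have "?D \<noteq> 0"
      by (auto simp: vnorm_zero)
    have "\<exists>!x\<in>cball z \<rho>. N x = x"
    proof (rule Banach_fix)
      show "complete (cball z \<rho>)"
        using complete by (rule complete_closed_subset[rotated 2]) auto
      show "cball z \<rho> \<noteq> {}"
        using \<rho>(1) by simp
      show "0 \<le> C * \<rho>" "C * \<rho> < 1"
        by fact+
      show "N ` cball z \<rho> \<subseteq> cball z \<rho>"
      proof
        fix y
        assume "y \<in> N ` cball z \<rho>"
        then obtain x where x: "x \<in> cball z \<rho>" and y: "y = N x"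
          by blast
        have "vnorm (poly q x - poly q z) \<le> vnorm ?D * \<rho>"
          using dist_eq[OF z x, of z] x \<rho>(1) s[OF z]
          by (auto simp: dist_vnorm vnorm_minus_commute intro!: mult_left_mono vnorm_nonneg)
        moreover have "vnorm (poly q z - w) \<le> vnorm ?D * \<rho>"
        proof -
          have "vnorm (poly q z - w) \<le> 1 * \<rho>"
            using w by (simp add: dist_vnorm)
          also have "\<dots> \<le> vnorm ?D * \<rho>"
            using D \<rho>(1) by (intro mult_right_mono) auto
          finally show ?thesis .
        qed
        ultimately have "vnorm (poly q x - w) \<le> vnorm ?D * \<rho>"
          using vnorm_ultrametric[of "poly q x - poly q z" "poly q z - w"] by simp
        then have "vnorm ((poly q x - w) / ?D) \<le> \<rho>"
          using D by (simp add: vnorm_divide divide_le_eq mult.commute)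
        then show "y \<in> cball z \<rho>"
          using x vnorm_ultrametric[of "z - x" "(poly q x - w) / ?D"]
          by (simp add: y N_def dist_vnorm algebra_simps)
      qed
      show "dist (N x) (N y) \<le> C * \<rho> * dist x y" if "x \<in> cball z \<rho>" "y \<in> cball z \<rho>" for x y
      proof -
        have "N x - N y = - ((poly q x - poly q y - ?D * (x - y)) / ?D)"
          using \<open>?D \<noteq> 0\<close> by (simp add: N_def field_simps)
        then have "dist (N x) (N y) = vnorm (poly q x - poly q y - ?D * (x - y)) / vnorm ?D"
          by (simp only: dist_vnorm vnorm_minus vnorm_divide)
        also have "\<dots> \<le> vnorm (poly q x - poly q y - ?D * (x - y)) / 1"
          using D by (intro divide_left_mono) (auto simp: vnorm_nonneg)
        finally show ?thesis
          using approx[OF z that] by (simp add: dist_vnorm)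
      qed
    qed
    then obtain x where "x \<in> cball z \<rho>" "N x = x"
      by blast
    then show "w \<in> poly q ` cball z \<rho>"
      using \<open>?D \<noteq> 0\<close> by (auto simp: N_def)
  qed
qed (fact complete dist_ultrametric \<rho> \<mu> continuous_on_poly_nonarch)+

text \<open>As \<open>d\<close> is at least 2, one factor \<open>vnorm z\<close> joins the leading
  coefficient to exceed \<open>K\<close>, and at least one more remains.\<close>

lemma poly_escape:
  fixes q :: "'a::nonarch_normed_field poly"
  assumes "degree q = d" "2 \<le> d" "1 < vnorm z"
    and "\<And>i. i < d \<Longrightarrow> vnorm (coeff q i) \<le> C"
    and "C < vnorm (coeff q d) * vnorm z" "K < vnorm (coeff q d) * vnorm z" "0 \<le> K"
  shows "K * vnorm z \<le> vnorm (poly q z)"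
proof -
  have "vnorm (poly q z) = vnorm (coeff q d) * vnorm z ^ d"
    using assms by (intro vnorm_poly_eq_lead) auto
  also have "\<dots> = (vnorm (coeff q d) * vnorm z) * vnorm z ^ (d - 1)"
    using assms(2) by (cases d) auto
  also have "\<dots> \<ge> K * vnorm z ^ 1"
    using assms by (intro mult_mono power_increasing) auto
  finally show ?thesis
    by simp
qed

lemma openin_Poly_top_near:
  assumes "d > 0"
  shows "openin (Poly_top d) {g. degree g = d \<and> (\<forall>i\<le>d. dist (coeff f i) (coeff g i) < \<eta>)}"
  (is "openin _ ?U")
proof -
  \<comment> \<open>The leading coefficient ranges over nonzero elements, so its ball loses 0; for
    polynomials of degree \<open>d > 0\<close> this excludes nothing.\<close>
  let ?S = "\<lambda>i. if i = d then - {0} \<inter> ball (coeff f i) \<eta> else ball (coeff f i) \<eta>"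
  have "openin (product_topology (\<lambda>i. if i = d then top_of_set (- {0}) else euclidean) {..d})
      (PiE {..d} ?S)"
    by (subst openin_PiE) (auto intro: openin_open_Int)
  moreover have "?U = (\<lambda>f. restrict (coeff f) {..d}) -` PiE {..d} ?S \<inter> {f. degree f = d}"
    using assms by (auto simp: PiE_iff split: if_splits)
  ultimately show ?thesis
    unfolding Poly_top_def openin_pullback_topology by blast
qed

lemma homeomorphic_map_isometry:
  assumes bij: "bij_betw h S T" and isom: "\<And>x y. x \<in> S \<Longrightarrow> y \<in> S \<Longrightarrow> dist (h x) (h y) = dist x y"
  shows "homeomorphic_map (top_of_set S) (top_of_set T) h"
proof -
  let ?k = "inv_into S h"
  have k: "?k y \<in> S" "h (?k y) = y" if "y \<in> T" for y
    using bij that by (auto simp: bij_betw_def inv_into_into f_inv_into_f)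
  have k_isom: "dist (?k x) (?k y) = dist x y" if "x \<in> T" "y \<in> T" for x y
    using isom[OF k(1)[OF that(1)] k(1)[OF that(2)]] k(2) that by simp
  have "continuous_on S h"
    unfolding continuous_on_iff using isom by metis
  moreover have "continuous_on T ?k"
    unfolding continuous_on_iff using k_isom by metis
  moreover have "h \<in> S \<rightarrow> T" "?k \<in> T \<rightarrow> S"
    using bij k(1) by (auto simp: bij_betw_def)
  ultimately have "homeomorphic_maps (top_of_set S) (top_of_set T) h ?k"
    using bij k(2) unfolding homeomorphic_maps_def
    by (auto simp: continuous_map_subtopology_eu bij_betw_def)
  then show ?thesis
    unfolding homeomorphic_map_maps by blast
qed

theorem theorem1p2:
  fixes p d :: nat
    and f :: "'a::nonarch_normed_field poly"
    and B :: "'a set"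
  assumes "prime p"
    and "is_padic_complex_field p TYPE('a)"
    and "d \<ge> 2"
    and "degree f = d"
    and "Julia (poly_map f) \<noteq> {}"
    and "B \<noteq> {}"
    and "\<exists>\<mu>>1. \<forall>z\<in>B. vnorm (poly (pderiv f) z) \<ge> \<mu>"
    and "poly f -` B \<subseteq> B"
    and "\<exists>M>0. B \<subseteq> cball 0 M"
    and "\<exists>\<delta>>0. \<forall>z\<in>B. cball z \<delta> \<subseteq> B"
  shows "J_stable d f"
proof -
  obtain L :: "'a set" where L: "alg_closed_subfield L" "closure L = UNIV"
    and complete: "complete (UNIV :: 'a set)"
    using assms(2) unfolding is_padic_complex_field_def is_alg_closure_of_def is_completion_of_def
    by blast
  have nontrivial: "\<exists>x::'a. x \<noteq> 0 \<and> vnorm x < e" if "e > 0" for e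
  proof -
    have "vnorm (of_rat x :: 'a) = padic_norm p x" for x
      using assms(2) unfolding is_padic_complex_field_def by simp
    from small_element_exists[OF assms(1) this that] show ?thesis
      by metis
  qed
  obtain \<mu> where \<mu>: "\<mu> > 1" "\<And>z. z \<in> B \<Longrightarrow> \<mu> \<le> vnorm (poly (pderiv f) z)"
    using assms(7) by blast
  obtain M where "M > 0" and M: "B \<subseteq> cball 0 M"
    using assms(9) by blast
  obtain \<delta> where \<delta>: "\<delta> > 0" "\<And>z. z \<in> B \<Longrightarrow> cball z \<delta> \<subseteq> B"
    using assms(10) by blast
  define c where "c = vnorm (coeff f d)"
  have "coeff f d \<noteq> 0"
    using assms(3,4) by auto
  then have "c > 0"
    using vnorm_nonneg[of "coeff f d"] vnorm_eq_0[of "coeff f d"] by (simp add: c_def order_less_le)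
  obtain C\<^sub>1 where C1: "gauss_le 1 f C\<^sub>1"
    using gauss_le_exists by (metis zero_le_one)
  \<comment> \<open>Beyond norm \<open>R\<close>, the product of \<open>c\<close> and the norm
    exceeds the coefficient bound \<open>C\<^sub>1\<close> as well as 1 and \<open>M\<close>. The
    disc of radius \<open>m\<close> contains \<open>B\<close> and all points that a nearby
    polynomial sends into \<open>B\<close>.\<close>
  define K where "K = max (max C\<^sub>1 1) M"
  define R where "R = max 1 (K / c)"
  define m where "m = max R M"
  have "1 \<le> m"
    by (simp add: m_def R_def)
  obtain C\<^sub>0 where C0: "gauss_le m f C\<^sub>0"
    using gauss_le_exists[of m] \<open>1 \<le> m\<close> by (metis order_trans zero_le_one)
  define C where "C = max C\<^sub>0 1"
  \<comment> \<open>The bound 1 lets nearby polynomials inherit \<open>C\<close> and the norm of the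
    derivative on \<open>B\<close>, \<delta> keeps balls inside \<open>B\<close>, and
    \<open>1 / (C + 1)\<close> ensures \<open>C * \<rho> < 1\<close>.\<close>
  define \<rho> where "\<rho> = min (min 1 \<delta>) (1 / (C + 1))"
  have "1 \<le> C"
    by (simp add: C_def)
  have \<rho>: "0 < \<rho>" "\<rho> \<le> 1" "\<rho> \<le> \<delta>"
    using \<delta>(1) \<open>1 \<le> C\<close> by (auto simp: \<rho>_def)
  have "C * \<rho> \<le> C * (1 / (C + 1))"
    using \<open>1 \<le> C\<close> by (intro mult_left_mono) (auto simp: \<rho>_def)
  also have "\<dots> < 1"
    using \<open>1 \<le> C\<close> by (simp add: divide_less_eq)
  finally have "C * \<rho> < 1" .
  \<comment> \<open>The bound \<open>c\<close> preserves the norm of the leading coefficient, and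
    \<open>\<rho> / m ^ d\<close> makes the Gauss norm of \<open>g - f\<close> at most
    \<rho>.\<close>
  define \<eta> where "\<eta> = min c (\<rho> / m ^ d)"
  have "\<eta> > 0"
    using \<open>c > 0\<close> \<rho>(1) \<open>1 \<le> m\<close> by (simp add: \<eta>_def)
  have \<eta>: "\<eta> * m ^ d \<le> \<rho>"
  proof -
    have "\<eta> * m ^ d \<le> \<rho> / m ^ d * m ^ d"
      using \<open>1 \<le> m\<close> by (intro mult_right_mono) (auto simp: \<eta>_def)
    then show ?thesis
      using \<open>1 \<le> m\<close> by simp
  qed
  have "\<eta> * 1 \<le> \<eta> * m ^ d"
    using \<open>\<eta> > 0\<close> \<open>1 \<le> m\<close> by (intro mult_left_mono) auto
  then have "\<eta> \<le> 1"
    using \<eta> \<rho>(2) by linarith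
  have B_le: "vnorm z \<le> M" "vnorm z \<le> m" if "z \<in> B" for z
    using M that by (auto simp: m_def dist_vnorm vnorm_minus)
  have cball_\<rho>: "cball z \<rho> \<subseteq> B" if "z \<in> B" for z
    using \<delta>(2)[OF that] \<rho>(3) by (meson order_trans subset_cball)
  define U where "U = {g. degree g = d \<and> (\<forall>i\<le>d. dist (coeff f i) (coeff g i) < \<eta>)}"
  define s where "s z = vnorm (poly (pderiv f) z)" for z
  \<comment> \<open>All \<open>g\<close> in \<open>U\<close> share the one \<open>s\<close> taken
    from \<open>f\<close>; the case \<open>g = f\<close> is included.\<close>
  have g_props: "(\<forall>z\<in>B. dist (poly f z) (poly g z) \<le> \<rho>) \<and> expanding_map B \<rho> s \<mu> (poly g) \<and>
      Julia (poly_map g) = Aff ` trapped B (poly g)" if "g \<in> U" for g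
  proof -
    have deg: "degree g = d" and near: "\<And>i. i \<le> d \<Longrightarrow> vnorm (coeff f i - coeff g i) < \<eta>"
      using that by (auto simp: U_def dist_vnorm)
    have diff: "gauss_le m (g - f) \<rho>"
      unfolding gauss_le_def
    proof
      fix i
      show "vnorm (coeff (g - f) i) * m ^ i \<le> \<rho>"
      proof (cases "i \<le> d")
        case True
        then have "vnorm (coeff (g - f) i) * m ^ i \<le> \<eta> * m ^ d"
          using near[OF True] \<open>1 \<le> m\<close> \<open>\<eta> > 0\<close>
          by (intro mult_mono power_increasing) (auto simp: vnorm_nonneg vnorm_minus_commute)
        then show ?thesis
          using \<eta> by simp
      next
        case False
        then show ?thesis
          using deg assms(4) \<rho>(1) by (simp add: coeff_eq_0 vnorm_zero)
      qed
    qed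
    have "gauss_le m (f + (g - f)) C"
    proof (rule gauss_le_add)
      show "gauss_le m f C" "gauss_le m (g - f) C"
        using gauss_le_mono[OF C0] gauss_le_mono[OF diff] \<rho>(2) by (auto simp: C_def)
    qed (use \<open>1 \<le> m\<close> in simp)
    then have g: "gauss_le m g C"
      by simp
    have close: "dist (poly f z) (poly g z) \<le> \<rho>" if "vnorm z \<le> m" for z
      using vnorm_poly_le[OF \<open>1 \<le> m\<close> diff that] by (simp add: dist_vnorm vnorm_minus_commute)
    have deriv: "s z = vnorm (poly (pderiv g) z)" if "z \<in> B" for z
    proof -
      have "vnorm (poly (pderiv f) z - poly (pderiv g) z) \<le> \<rho>"
        using vnorm_poly_pderiv_le[OF \<open>1 \<le> m\<close> diff B_le(2)[OF that]]
        by (simp add: pderiv_diff vnorm_minus_commute)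
      then show ?thesis
        using \<rho>(2) \<mu>(1) \<mu>(2)[OF that] unfolding s_def
        by (intro vnorm_eq_of_diff_less[symmetric]) simp
    qed
    have expanding: "expanding_map B \<rho> s \<mu> (poly g)"
      using \<mu>(2) by (intro expanding_map_poly[OF complete \<open>1 \<le> m\<close> g] B_le(2) \<rho>(1) \<open>C * \<rho> < 1\<close>
          cball_\<rho> \<mu>(1) deriv) (auto simp: s_def)
    \<comment> \<open>The factor 1 gives escape to infinity; the factor \<open>M\<close> shows that
      points beyond \<open>R\<close> are not mapped into \<open>B\<close>.\<close>
    have far: "max 1 M * vnorm z \<le> vnorm (poly g z)" if z: "R < vnorm z" for z
    proof (rule poly_escape[OF deg assms(3)])
      show "1 < vnorm z"
        using z by (simp add: R_def)
      have lead: "vnorm (coeff g d) = c"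
        using near[of d] unfolding c_def by (intro vnorm_eq_of_diff_less) (simp add: \<eta>_def c_def)
      have "K < c * vnorm z"
        using z \<open>c > 0\<close> by (simp add: R_def divide_less_eq mult.commute)
      then show "max C\<^sub>1 1 < vnorm (coeff g d) * vnorm z" "max 1 M < vnorm (coeff g d) * vnorm z"
        unfolding lead by (auto simp: K_def)
      show "vnorm (coeff g i) \<le> max C\<^sub>1 1" if "i < d" for i
        using vnorm_diff_ultrametric[of "coeff f i" "coeff f i - coeff g i"] near[of i] that \<open>\<eta> \<le> 1\<close> C1
        unfolding gauss_le_def by (auto simp: max_def split: if_splits dest: spec[of _ i])
    qed simp
    have escape: "vnorm z \<le> vnorm (poly g z)" if "R < vnorm z" for z
      using far[OF that] mult_right_mono[of 1 "max 1 M" "vnorm z"] by (simp add: vnorm_nonneg)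
    have "poly g -` B \<subseteq> B"
    proof
      fix z
      assume z: "z \<in> poly g -` B"
      have "vnorm z \<le> R"
      proof (rule ccontr)
        assume "\<not> vnorm z \<le> R"
        then have "R < vnorm z" "1 < vnorm z"
          by (auto simp: R_def)
        then have "M * 1 < max 1 M * vnorm z"
          using \<open>M > 0\<close> by (intro mult_le_less_imp_less) auto
        then show False
          using far[OF \<open>R < vnorm z\<close>] B_le(1)[of "poly g z"] z by simp
      qed
      then have "vnorm z \<le> m"
        by (simp add: m_def le_max_iff_disj)
      \<comment> \<open>The margin \<delta> of \<open>B\<close> moves \<open>poly f z\<close> into
        \<open>B\<close>, which reduces the claim to backward invariance under
        \<open>f\<close>.\<close>
      then have "dist (poly g z) (poly f z) \<le> \<delta>"
        using close[of z] \<rho>(3) by (simp add: dist_commute)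
      then have "poly f z \<in> B"
        using \<delta>(2)[of "poly g z"] z by (auto simp: subset_iff)
      then show "z \<in> B"
        using assms(8) by blast
    qed
    then have "Julia (poly_map g) = Aff ` trapped B (poly g)"
      by (intro Julia_eq_trapped[OF L assms(6) _ M \<delta> escape expanding nontrivial])
    then show ?thesis
      using close B_le(2) expanding by blast
  qed
  have "f \<in> U"
    using assms(4) \<open>\<eta> > 0\<close> by (simp add: U_def)
  have "\<exists>h. homeomorphic_map (top_of_set (Julia (poly_map f))) (top_of_set (Julia (poly_map g))) h \<and>
      (\<forall>x\<in>Julia (poly_map f). h (poly_map f x) = poly_map g (h x))" if "g \<in> U" for g
  proof -
    let ?Jf = "trapped B (poly f)" and ?Jg = "trapped B (poly g)"
    have Julia: "Julia (poly_map f) = Aff ` ?Jf" "Julia (poly_map g) = Aff ` ?Jg"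
      and expanding: "expanding_map B \<rho> s \<mu> (poly f)" "expanding_map B \<rho> s \<mu> (poly g)"
      and fg: "\<And>z. z \<in> B \<Longrightarrow> dist (poly f z) (poly g z) \<le> \<rho>"
      using g_props[OF \<open>f \<in> U\<close>] g_props[OF that] by simp_all
    obtain h where bij: "bij_betw h ?Jf ?Jg"
      and conj: "\<And>z. z \<in> ?Jf \<Longrightarrow> h (poly f z) = poly g (h z)"
      and close: "\<And>z. z \<in> ?Jf \<Longrightarrow> dist z (h z) \<le> \<rho>"
      and isom: "\<And>z w. z \<in> ?Jf \<Longrightarrow> w \<in> ?Jf \<Longrightarrow> dist (h z) (h w) = dist z w"
      using isometric_conjugacy[OF expanding fg] by blast
    \<comment> \<open>The value at \<open>Infty\<close> only makes \<open>H\<close> total, as both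
      Julia sets consist of affine points.\<close>
    define H where "H x = (case x of Aff z \<Rightarrow> Aff (h z) | Infty \<Rightarrow> Infty)" for x
    \<comment> \<open>A displacement by at most \<open>\<rho> \<le> 1\<close> preserves the chordal
      denominators, so the affine isometry is also a chordal one.\<close>
    have max_eq: "max (vnorm (h z)) 1 = max (vnorm z) 1" if "z \<in> ?Jf" for z
      using close[OF that] \<rho>(2) vnorm_diff_ultrametric[of z "z - h z"] vnorm_ultrametric[of "z - h z" "h z"]
      by (auto simp: dist_vnorm max_def split: if_splits)
    have "homeomorphic_map (top_of_set (Aff ` ?Jf)) (top_of_set (Aff ` ?Jg)) H"
    proof (rule homeomorphic_map_isometry)
      show "bij_betw H (Aff ` ?Jf) (Aff ` ?Jg)"
        using bij unfolding bij_betw_def inj_on_def by (force simp: H_def image_iff)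
      show "dist (H x) (H y) = dist x y" if "x \<in> Aff ` ?Jf" "y \<in> Aff ` ?Jf" for x y
        using that isom max_eq by (auto simp: H_def dist_proj_line_def dist_vnorm)
    qed
    then show ?thesis
      unfolding Julia using conj by (intro exI[of _ H]) (auto simp: H_def)
  qed
  moreover have "openin (Poly_top d) U"
    unfolding U_def using assms(3) by (intro openin_Poly_top_near) simp
  ultimately show ?thesis
    unfolding J_stable_def using \<open>f \<in> U\<close> by blast
qed

end
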